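(* Let $X$ be a two-sided shift space on a finite alphabet and $\varphi\colon X\to\mathbb R$ a continuous potential. Let $\mathcal R$ be an $\mathcal L$-invariant family of rectangles, and suppose that the family of unstable leaf measures $m^{\mathrm u}_x$ is positive on $\mathcal R$. Then the following are equivalent. (1) The leaf measures $m^{\mathrm u}_x$ have uniformly continuous holonomies on $\mathcal R$. (2) The sum $$\Delta^s(x',x):=\sum_{n=0}^\infty\big(\varphi(\sigma^nx')-\varphi(\sigma^nx)\big)$$ converges uniformly on $\{(x,x')\in R^2:R\in\mathcal R,\ x'\in W^{\mathrm s}_R(x)\}$, is uniformly bounded on this set, and for every $R\in\mathcal R$ and $y,z\in R$ we have $$\frac{d(\pi^s_{z,y})_*m^{\mathrm u}_z}{dm^{\mathrm u}_y}(x)=e^{\Delta^s((\pi^s_{z,y})^{-1}(x),x)}$$ (as measures on $W^{\mathrm u}_R(y)$).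
   Context: Let $A$ be a finite set and $\sigma\colon A^{\mathbb Z}\to A^{\mathbb Z}$ the shift $(\sigma x)_n=x_{n+1}$; $A^{\mathbb Z}$ has the metric $d(x,y)=2^{-\min\{|n|:x_n\ne y_n\}}$. A two-sided shift space is a (nonempty) closed $\sigma$-invariant set $X\subset A^{\mathbb Z}$. For $w\in A^n$ (length $|w|=n$) let $[w]^+=\{x\in X:x_{[0,n)}=w\}$ and $[w]^-=\{x\in X:x_{(-n,0]}=w\}$; $\mathcal L_n=\{w\in A^n:[w]^+\ne\emptyset\}$, $\mathcal L=\bigcup_{n\ge0}\mathcal L_n$ (the language of $X$), $\mathcal L_{\ge N}=\{w\in\mathcal L:|w|\ge N\}$. Let $S_n\varphi(x)=\sum_{k=0}^{n-1}\varphi(\sigma^kx)$, $\Phi(w)=\sup_{x\in[w]^+}S_{|w|}\varphi(x)$, $\Lambda_n=\sum_{w\in\mathcal L_n}e^{\Phi(w)}$, $P=\lim_n\frac1n\log\Lambda_n$. Leaves and unstable leaf measures: $W^{\mathrm u}_{\mathrm{loc}}(x)=\{y\in X:y_k=x_k\ \forall k\le0\}$, $W^{\mathrm s}_{\mathrm{loc}}(x)=\{y\in X:y_k=x_k\ \forall k\ge0\}$; $\Phi^+_x(w)=\sup\{S_{|w|}\varphi(y):y\in W^{\mathrm u}_{\mathrm{loc}}(x)\cap[w]^+\}$ ($\sup\emptyset=-\infty$, $e^{-\infty}=0$); $\mathbb E^+(Z,N)=\{\mathcal E\subset\mathcal L_{\ge N}:Z\subset\bigcup_{w\in\mathcal E}[w]^+\}$;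 $$m^{\mathrm u}_x(Z)=\lim_{N\to\infty}\inf\Big\{\sum_{w\in\mathcal E}e^{\Phi^+_x(w)-|w|P}:\mathcal E\in\mathbb E^+(Z,N)\Big\}\quad(Z\subset W^{\mathrm u}_{\mathrm{loc}}(x)),$$ which is a Borel measure on $W^{\mathrm u}_{\mathrm{loc}}(x)$. Rectangles and holonomies: for $x,y\in X$ with $x_0=y_0$, $[x,y]$ is the sequence with $[x,y]_n=x_n$ for $n\le0$ and $[x,y]_n=y_n$ for $n\ge0$. A set $R\subset X$ is a rectangle if for all $x,y\in R$ the bracket $[x,y]$ is defined (so $x_0=y_0$) and lies in $R$. For $x\in R$, $W^{\mathrm u}_R(x)=W^{\mathrm u}_{\mathrm{loc}}(x)\cap R$ and $W^{\mathrm s}_R(x)=W^{\mathrm s}_{\mathrm{loc}}(x)\cap R$. For $z,y\in R$ the stable holonomy $\pi^s_{z,y}\colon W^{\mathrm u}_R(z)\to W^{\mathrm u}_R(y)$ is $\pi^s_{z,y}(x)=[y,x]$. A family $\mathcal R$ of rectangles is $\mathcal L$-invariant if for all $R\in\mathcal R$, $n\in\mathbb N$, $w\in\mathcal L_{n+1}$, the rectangles $\sigma^n(R\cap[w]^+)$ and $\sigma^{-n}(R\cap[w]^-)$ belong to $\mathcal R$ (nonempty ones being understood). The family $m^{\mathrm u}_x$ is positive on $\mathcal R$ if for every $R\in\mathcal R$ there is $x\in R$ with $m^{\mathrm u}_x(W^{\mathrm u}_R(x))>0$. The leaf measures $m^{\mathrm u}_x$ have uniformly continuous holonomies on $\mathcal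 R$ if for every $\epsilon>0$ there is $\delta>0$ such that for all $R\in\mathcal R$ and $y,z\in R$ with $d(y,z)<\delta$ we have $e^{-\epsilon}m^{\mathrm u}_z(\pi^s_{y,z}(Y))\le m^{\mathrm u}_y(Y)\le e^{\epsilon}m^{\mathrm u}_z(\pi^s_{y,z}(Y))$ for all measurable $Y\subset W^{\mathrm u}_R(y)$.
   Formalization: The formal statement additionally assumes that, for every R in the family and y in R, the leaf measure m^u_y restricted to W^u_R(y) is σ-finite; without this (1) ⇒ (2) can fail, for example when points have infinite leaf measure. *)

theory Defs
  imports "HOL-Analysis.Analysis"
begin

section \<open>Two-sided shift spaces\<close>

type_synonym 'a biseq = "int \<Rightarrow> 'a"

definition shift :: "'a biseq \<Rightarrow> 'a biseq" where
  "shift x = (\<lambda>n. x (n + 1))"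

definition bidist :: "'a biseq \<Rightarrow> 'a biseq \<Rightarrow> real" where
  "bidist x y = (if x = y then 0 else (1/2) ^ (LEAST k. \<exists>n. nat \<bar>n\<bar> = k \<and> x n \<noteq> y n))"

lemma bidist_agree:
  assumes "bidist x y < (1/2) ^ k" and "nat \<bar>n\<bar> \<le> k"
  shows "x n = y n"
proof (rule ccontr)
  assume n: "x n \<noteq> y n"
  then have "(LEAST k. \<exists>n. nat \<bar>n\<bar> = k \<and> x n \<noteq> y n) \<le> nat \<bar>n\<bar>"
    by (intro Least_le) auto
  then have "(1/2::real) ^ k \<le> (1/2) ^ (LEAST k. \<exists>n. nat \<bar>n\<bar> = k \<and> x n \<noteq> y n)"
    using assms(2) by (intro power_decreasing) auto
  moreover have "x \<noteq> y" using n by auto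
  ultimately show False using assms(1) by (simp add: bidist_def)
qed

lemma bidist_ultra: "bidist x z \<le> max (bidist x y) (bidist y z)"
proof (cases "x = z")
  case False
  define k where "k = (LEAST k. \<exists>n. nat \<bar>n\<bar> = k \<and> x n \<noteq> z n)"
  obtain n0 where "x n0 \<noteq> z n0" using False by (meson ext)
  then have "\<exists>n. nat \<bar>n\<bar> = k \<and> x n \<noteq> z n"
    unfolding k_def by (intro LeastI[of "\<lambda>k. \<exists>n. nat \<bar>n\<bar> = k \<and> x n \<noteq> z n"]) blast
  then obtain n where n: "nat \<bar>n\<bar> = k" "x n \<noteq> z n" by auto
  have "bidist x z = (1/2) ^ k" using False by (simp add: bidist_def k_def)
  moreover have "\<not> (bidist x y < (1/2) ^ k \<and> bidist y z < (1/2) ^ k)"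
    using n bidist_agree[of x y k n] bidist_agree[of y z k n] by auto
  ultimately show ?thesis by linarith
qed (simp add: bidist_def le_max_iff_disj)

lemma Metric_space_bidist: "Metric_space UNIV bidist"
proof
  fix x y z :: "'a biseq"
  show nonneg: "0 \<le> bidist u v" for u v :: "'a biseq" by (simp add: bidist_def)
  have "(\<exists>n. nat \<bar>n\<bar> = k \<and> x n \<noteq> y n) = (\<exists>n. nat \<bar>n\<bar> = k \<and> y n \<noteq> x n)" for k
    by metis
  then show "bidist x y = bidist y x"
    unfolding bidist_def by (cases "x = y") simp_all
  show "bidist x y = 0 \<longleftrightarrow> x = y" by (simp add: bidist_def)
  show "bidist x z \<le> bidist x y + bidist y z"
    using bidist_ultra[of x z y] nonneg[of x y] nonneg[of y z] by linarith
qed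

abbreviation bitop :: "'a biseq topology" where
  "bitop \<equiv> Metric_space.mtopology UNIV bidist"

definition shift_space :: "'a biseq set \<Rightarrow> bool" where
  "shift_space X \<longleftrightarrow> X \<noteq> {} \<and> closedin bitop X \<and> shift ` X = X"

section \<open>Language and pressure\<close>

definition cyl_plus :: "'a biseq set \<Rightarrow> 'a list \<Rightarrow> 'a biseq set" where
  "cyl_plus X w = {x \<in> X. \<forall>i<length w. x (int i) = w ! i}"

text \<open>The word is read off at the coordinates \<open>-length w + 1, \<dots>, 0\<close>.\<close>

definition cyl_minus :: "'a biseq set \<Rightarrow> 'a list \<Rightarrow> 'a biseq set" where
  "cyl_minus X w = {x \<in> X. \<forall>i<length w. x (int i - int (length w) + 1) = w ! i}"

definition lang :: "'a biseq set \<Rightarrow> nat \<Rightarrow> 'a list set" where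
  "lang X n = {w. length w = n \<and> cyl_plus X w \<noteq> {}}"

definition lang_ge :: "'a biseq set \<Rightarrow> nat \<Rightarrow> 'a list set" where
  "lang_ge X N = {w \<in> (\<Union>n. lang X n). N \<le> length w}"

definition birkhoff :: "('a biseq \<Rightarrow> real) \<Rightarrow> nat \<Rightarrow> 'a biseq \<Rightarrow> real" where
  "birkhoff \<phi> n x = (\<Sum>k<n. \<phi> ((shift ^^ k) x))"

definition Phi :: "'a biseq set \<Rightarrow> ('a biseq \<Rightarrow> real) \<Rightarrow> 'a list \<Rightarrow> real" where
  "Phi X \<phi> w = (SUP x\<in>cyl_plus X w. birkhoff \<phi> (length w) x)"

definition Lambda :: "'a biseq set \<Rightarrow> ('a biseq \<Rightarrow> real) \<Rightarrow> nat \<Rightarrow> real" where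
  "Lambda X \<phi> n = (\<Sum>w\<in>lang X n. exp (Phi X \<phi> w))"

definition pressure :: "'a biseq set \<Rightarrow> ('a biseq \<Rightarrow> real) \<Rightarrow> real" where
  "pressure X \<phi> = lim (\<lambda>n. ln (Lambda X \<phi> n) / real n)"

section \<open>Leaves and leaf measures\<close>

definition Wu_loc :: "'a biseq set \<Rightarrow> 'a biseq \<Rightarrow> 'a biseq set" where
  "Wu_loc X x = {y \<in> X. \<forall>k\<le>0. y k = x k}"

definition Ws_loc :: "'a biseq set \<Rightarrow> 'a biseq \<Rightarrow> 'a biseq set" where
  "Ws_loc X x = {y \<in> X. \<forall>k\<ge>0. y k = x k}"

text \<open>In \<^typ>\<open>ereal\<close> the supremum of the empty set is \<open>-\<infinity>\<close>.\<close>

definition Phi_plus :: "'a biseq set \<Rightarrow> ('a biseq \<Rightarrow> real) \<Rightarrow> 'a biseq \<Rightarrow> 'a list \<Rightarrow> ereal" where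
  "Phi_plus X \<phi> x w = (SUP y\<in>Wu_loc X x \<inter> cyl_plus X w. ereal (birkhoff \<phi> (length w) y))"

definition exp_ereal :: "ereal \<Rightarrow> ennreal" where
  "exp_ereal a = (case a of ereal r \<Rightarrow> ennreal (exp r) | PInfty \<Rightarrow> \<infinity> | MInfty \<Rightarrow> 0)"

definition covers :: "'a biseq set \<Rightarrow> 'a biseq set \<Rightarrow> nat \<Rightarrow> 'a list set set" where
  "covers X Z N = {E. E \<subseteq> lang_ge X N \<and> Z \<subseteq> (\<Union>w\<in>E. cyl_plus X w)}"

definition mu :: "'a biseq set \<Rightarrow> ('a biseq \<Rightarrow> real) \<Rightarrow> 'a biseq \<Rightarrow> 'a biseq set \<Rightarrow> ennreal" where
  "mu X \<phi> x Z = lim (\<lambda>N. INF E\<in>covers X Z N.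
     \<Sum>\<^sub>\<infinity>w\<in>E. exp_ereal (Phi_plus X \<phi> x w - ereal (real (length w) * pressure X \<phi>)))"

section \<open>Rectangles and holonomies\<close>

definition bracket :: "'a biseq \<Rightarrow> 'a biseq \<Rightarrow> 'a biseq" where
  "bracket x y = (\<lambda>n. if n \<le> 0 then x n else y n)"

definition rectangle :: "'a biseq set \<Rightarrow> 'a biseq set \<Rightarrow> bool" where
  "rectangle X R \<longleftrightarrow> R \<subseteq> X \<and> (\<forall>x\<in>R. \<forall>y\<in>R. x 0 = y 0 \<and> bracket x y \<in> R)"

definition Wu :: "'a biseq set \<Rightarrow> 'a biseq set \<Rightarrow> 'a biseq \<Rightarrow> 'a biseq set" where
  "Wu X R x = Wu_loc X x \<inter> R"

definition Ws :: "'a biseq set \<Rightarrow> 'a biseq set \<Rightarrow> 'a biseq \<Rightarrow> 'a biseq set" where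
  "Ws X R x = Ws_loc X x \<inter> R"

text \<open>The stable holonomy from the unstable leaf of \<open>z\<close> to that of \<open>y\<close>.\<close>

definition hol :: "'a biseq \<Rightarrow> 'a biseq \<Rightarrow> 'a biseq \<Rightarrow> 'a biseq" where
  "hol z y x = bracket y x"

text \<open>Rectangles need not be Borel, so measurability on a leaf of a rectangle refers to the Borel
  sets of that leaf as a topological space in its own right.\<close>

definition leaf_measure ::
  "'a biseq set \<Rightarrow> ('a biseq \<Rightarrow> real) \<Rightarrow> 'a biseq set \<Rightarrow> 'a biseq \<Rightarrow> 'a biseq measure" where
  "leaf_measure X \<phi> R x =
     measure_of (Wu X R x) {U. openin (subtopology bitop (Wu X R x)) U} (mu X \<phi> x)"

text \<open>\<open>(shift ^^ n) -` S\<close> is the image of \<open>S\<close> under the \<open>n\<close>-th power of the inverse shift.\<close>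

definition lang_invariant :: "'a biseq set \<Rightarrow> 'a biseq set set \<Rightarrow> bool" where
  "lang_invariant X \<R> \<longleftrightarrow> (\<forall>R\<in>\<R>. \<forall>n. \<forall>w\<in>lang X (n + 1).
     (R \<inter> cyl_plus X w \<noteq> {} \<longrightarrow> (shift ^^ n) ` (R \<inter> cyl_plus X w) \<in> \<R>) \<and>
     (R \<inter> cyl_minus X w \<noteq> {} \<longrightarrow> (shift ^^ n) -` (R \<inter> cyl_minus X w) \<in> \<R>))"

definition positive_on ::
  "'a biseq set \<Rightarrow> ('a biseq \<Rightarrow> real) \<Rightarrow> 'a biseq set set \<Rightarrow> bool" where
  "positive_on X \<phi> \<R> \<longleftrightarrow> (\<forall>R\<in>\<R>. \<exists>x\<in>R. 0 < mu X \<phi> x (Wu X R x))"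

definition unif_cont_holonomies ::
  "'a biseq set \<Rightarrow> ('a biseq \<Rightarrow> real) \<Rightarrow> 'a biseq set set \<Rightarrow> bool" where
  "unif_cont_holonomies X \<phi> \<R> \<longleftrightarrow>
     (\<forall>\<epsilon>>0. \<exists>\<delta>>0. \<forall>R\<in>\<R>. \<forall>y\<in>R. \<forall>z\<in>R. bidist y z < \<delta> \<longrightarrow>
        (\<forall>Y\<in>sets (leaf_measure X \<phi> R y).
           ennreal (exp (- \<epsilon>)) * mu X \<phi> z (hol y z ` Y) \<le> mu X \<phi> y Y \<and>
           mu X \<phi> y Y \<le> ennreal (exp \<epsilon>) * mu X \<phi> z (hol y z ` Y)))"

definition Delta_s :: "('a biseq \<Rightarrow> real) \<Rightarrow> 'a biseq \<Rightarrow> 'a biseq \<Rightarrow> real" where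
  "Delta_s \<phi> x' x = (\<Sum>n. \<phi> ((shift ^^ n) x') - \<phi> ((shift ^^ n) x))"

definition stable_pairs :: "'a biseq set \<Rightarrow> 'a biseq set set \<Rightarrow> ('a biseq \<times> 'a biseq) set" where
  "stable_pairs X \<R> = {(x, x'). \<exists>R\<in>\<R>. x \<in> R \<and> x' \<in> Ws X R x}"

text \<open>\<open>f\<close> is a version of the Radon--Nikodym derivative of \<open>N\<close> with respect to \<open>M\<close>; for
  \<open>\<sigma>\<close>-finite \<open>M\<close> this determines \<open>f\<close> almost everywhere (cf. \<^const>\<open>RN_deriv\<close>).\<close>

definition is_RN_deriv :: "'b measure \<Rightarrow> 'b measure \<Rightarrow> ('b \<Rightarrow> ennreal) \<Rightarrow> bool" where
  "is_RN_deriv M N f \<longleftrightarrow> f \<in> borel_measurable M \<and> density M f = N"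

end

theory Submission
  imports Defs
begin

text \<open>The leaf measures are conformal: on a leaf, \<open>shift ^^ n\<close> multiplies \<^term>\<open>mu X \<phi>\<close> by the density
  \<open>exp (n * pressure X \<phi> - birkhoff \<phi> n)\<close>. A stable holonomy from the leaf of \<open>y\<close> to that of \<open>z\<close> becomes, after
  applying \<open>shift ^^ n\<close> to a piece of the rectangle following one word of length \<open>n + 1\<close>, a holonomy
  between leaves at distance at most \<open>2\<^sup>-\<^sup>n\<close>. If holonomies between nearby leaves are almost
  measure preserving, then near \<open>x\<close> the original one has density \<open>exp\<close> of the \<open>n\<close>-th partial sum
  of \<open>Delta_s\<close> at \<open>x\<close>, up to a factor tending to 1 uniformly. Positivity provides sets of
  positive finite measure in every cylinder around every point of a leaf, and comparing the
  densities obtained from \<open>n\<close> and \<open>m\<close> on them shows that the partial sums are uniformly Cauchy;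
  their limit is then the logarithm of the density. Conversely, by uniform convergence and uniform
  continuity of the partial sums, \<open>Delta_s\<close> is uniformly small for nearby leaves.\<close>

section \<open>Extended nonnegative reals\<close>

text \<open>The obstacle is that the leaf measures may be infinite and that \<open>mu\<close> is an
  outer measure given by covers, so densities cannot simply be divided or differentiated. Every
  estimate is therefore an inequality \<open>a \<le> ennreal (exp t) * b\<close>, in which the
  positive real factor can be moved across even if \<open>a\<close> or \<open>b\<close> is infinite.
  Conformality is used only as two such inequalities with a constant factor: an unstable leaf fixes
  the past, so on a long enough cylinder \<open>birkhoff \<phi> n\<close> is constant up to a
  prescribed \<eta>. The pressure contributes inverse factors on the two leaves and cancels. Each
  comparison of two leaves costs the holonomy error \<open>e\<close> and one oscillation \<eta> on
  each leaf, which is the origin of \<open>e + 2 * \<eta>\<close>. Cylinders of a fixed length form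
  a finite partition, so local comparisons add up even on sets of infinite measure. A measure has to
  be cancelled only for the Cauchy property; there sigma-finiteness cuts a set of positive measure
  down to finite measure.\<close>

lemma infsum_le_reindex_ennreal:
  fixes f :: "'b \<Rightarrow> ennreal" and g :: "'c \<Rightarrow> ennreal"
  assumes inj: "inj_on h A" and sub: "h ` A \<subseteq> B" and le: "\<And>a. a \<in> A \<Longrightarrow> f a \<le> c * g (h a)"
  shows "infsum f A \<le> c * infsum g B"
proof -
  have "sum f F \<le> c * infsum g B" if F: "finite F" "F \<subseteq> A" for F
  proof -
    have "sum f F \<le> (\<Sum>a\<in>F. c * g (h a))"
      using F le by (intro sum_mono) auto
    also have "\<dots> = c * sum g (h ` F)"
      using inj_on_subset[OF inj F(2)] by (simp add: sum_distrib_left sum.reindex)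
    also have "sum g (h ` F) \<le> infsum g B"
      unfolding nonneg_infsum_complete[of B g, simplified]
      using F sub by (intro SUP_upper) auto
    finally show ?thesis by (simp add: mult_left_mono)
  qed
  then show ?thesis
    unfolding nonneg_infsum_complete[of A f, simplified] by (intro SUP_least) auto
qed

text \<open>The sets \<open>E i\<close> may overlap. Each element \<open>a\<close> of a finite
  \<open>F\<close> is charged to one chosen index \<open>j a\<close>, which splits \<open>F\<close>
  into finitely many disjoint groups.\<close>

lemma infsum_UN_le_ennreal:
  fixes f :: "'b \<Rightarrow> ennreal"
  shows "infsum f (\<Union>i. E i) \<le> (\<Sum>i::nat. infsum f (E i))"
proof -
  have "sum f F \<le> (\<Sum>i. infsum f (E i))" if F: "finite F" "F \<subseteq> (\<Union>i. E i)" for F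
  proof -
    obtain j where j: "\<And>a. a \<in> F \<Longrightarrow> a \<in> E (j a)" using F by (metis UN_E subsetD)
    obtain n where n: "j ` F \<subseteq> {..<n}"
      using finite_nat_bounded[of "j ` F"] F(1) by auto
    have "sum f F = (\<Sum>i<n. sum f {a\<in>F. j a = i})"
      using F(1) n by (intro sum.group[symmetric]) auto
    also have "\<dots> \<le> (\<Sum>i<n. infsum f (E i))"
    proof (intro sum_mono)
      fix i
      show "sum f {a\<in>F. j a = i} \<le> infsum f (E i)"
        unfolding nonneg_infsum_complete[of "E i" f, simplified]
        using F j by (intro SUP_upper) auto
    qed
    also have "\<dots> \<le> (\<Sum>i. infsum f (E i))" by (intro sum_le_suminf) auto
    finally show ?thesis .
  qed
  then show ?thesis
    unfolding nonneg_infsum_complete[of "\<Union>i. E i" f, simplified] by (intro SUP_least) auto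
qed

lemma ennreal_exp_mult:
  "ennreal (exp s) * (ennreal (exp t) * c) = ennreal (exp (s + t)) * c"
  by (simp add: exp_add ennreal_mult mult.assoc)

text \<open>The value \<open>exp t\<close> is invertible with inverse \<open>exp (- t)\<close>, so
  the equivalence survives infinite \<open>a\<close> and \<open>b\<close>.\<close>

lemma ennreal_exp_mult_le_iff:
  "a \<le> ennreal (exp t) * b \<longleftrightarrow> ennreal (exp (- t)) * a \<le> b"
proof -
  have *: "ennreal (exp s) * (ennreal (exp (- s)) * c) = c" for s c
    by (simp add: mult.assoc[symmetric] ennreal_mult[symmetric] exp_minus)
  show ?thesis
    using *[of t a] *[of "- t" b] mult_left_mono[of a "ennreal (exp t) * b" "ennreal (exp (- t))"]
      mult_left_mono[of "ennreal (exp (- t)) * a" b "ennreal (exp t)"] by auto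
qed

text \<open>Moving the factor to the left first reduces this to the defining property of the
  infimum, so no continuity of multiplication at infinity enters.\<close>

lemma ennreal_le_exp_INF:
  assumes "\<And>i. i \<in> I \<Longrightarrow> a \<le> ennreal (exp t) * g i"
  shows "a \<le> ennreal (exp t) * (INF i\<in>I. g i)"
  using assms unfolding ennreal_exp_mult_le_iff by (intro INF_greatest)

text \<open>For finite \<open>b\<close> the case \<open>e = 1\<close> shows that \<open>a\<close> is
  finite, and then \<open>e\<close> tends to 0 among real numbers.\<close>

lemma ennreal_le_of_exp_mult:
  assumes "\<And>e. 0 < e \<Longrightarrow> a \<le> ennreal (exp e) * b"
  shows "a \<le> b"
proof (cases b)
  case (real r)
  have "a < top"
    using assms[of 1] real by (simp add: ennreal_mult[symmetric] le_less_trans)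
  then obtain s where s: "a = ennreal s" "0 \<le> s" by (cases a) auto
  have "s \<le> exp e * r" if "0 < e" for e
    using assms[OF that] real s by (simp add: ennreal_mult[symmetric])
  then have "\<forall>\<^sub>F e in at_right 0. s \<le> exp e * r"
    by (auto simp: eventually_at_right_field intro: exI[of _ 1])
  moreover have "((\<lambda>e. exp e * r) \<longlongrightarrow> exp 0 * r) (at_right 0)"
    by (intro tendsto_intros)
  ultimately have "s \<le> exp 0 * r"
    by (intro tendsto_lowerbound[where f = "\<lambda>e. exp e * r"]) auto
  then show ?thesis using real s by simp
qed simp

section \<open>The leaf measures\<close>

lemma shift_funpow: "(shift ^^ n) x = (\<lambda>i. x (i + int n))"
  by (induction n) (auto simp: shift_def algebra_simps)

definition unshift :: "nat \<Rightarrow> 'a biseq \<Rightarrow> 'a biseq" where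
  "unshift n x = (\<lambda>i. x (i - int n))"

lemma shift_unshift [simp]: "(shift ^^ n) (unshift n x) = x"
  and unshift_shift [simp]: "unshift n ((shift ^^ n) x) = x"
  by (simp_all add: shift_funpow unshift_def)

lemma inj_shift_funpow: "inj (shift ^^ n)"
  by (metis injI unshift_shift)

lemma birkhoff_add: "birkhoff \<phi> (m + n) x = birkhoff \<phi> m x + birkhoff \<phi> n ((shift ^^ m) x)"
proof -
  have "(\<Sum>k = m..<m + n. \<phi> ((shift ^^ k) x)) = (\<Sum>k<n. \<phi> ((shift ^^ k) ((shift ^^ m) x)))"
    using sum.shift_bounds_nat_ivl[of "\<lambda>k. \<phi> ((shift ^^ k) x)" 0 m n]
    by (simp add: funpow_add add.commute lessThan_atLeast0)
  then show ?thesis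
    unfolding birkhoff_def lessThan_atLeast0
    using sum.atLeastLessThan_concat[of 0 m "m + n" "\<lambda>k. \<phi> ((shift ^^ k) x)"] by simp
qed

section \<open>Word weights and the outer measure on a leaf\<close>

definition leaf_weight ::
  "'a biseq set \<Rightarrow> ('a biseq \<Rightarrow> real) \<Rightarrow> 'a biseq \<Rightarrow> 'a list \<Rightarrow> ennreal" where
  "leaf_weight X \<phi> x w = (SUP y\<in>Wu_loc X x \<inter> cyl_plus X w.
     ennreal (exp (birkhoff \<phi> (length w) y - real (length w) * pressure X \<phi>)))"

lemma exp_ereal_mono: "a \<le> b \<Longrightarrow> exp_ereal a \<le> exp_ereal b"
  by (cases a; cases b) (auto simp: exp_ereal_def intro: ennreal_leI)

text \<open>The exponential commutes with the supremum: monotonicity gives one inequality, and the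
  logarithm of a finite upper bound gives the other. Having the supremum directly in
  \<open>ennreal\<close> lets weights be compared point by point.\<close>

lemma exp_ereal_Phi_plus:
  "exp_ereal (Phi_plus X \<phi> x w - ereal (real (length w) * pressure X \<phi>)) = leaf_weight X \<phi> x w"
proof -
  define A where "A = Wu_loc X x \<inter> cyl_plus X w"
  define S where "S = birkhoff \<phi> (length w)"
  define c where "c = real (length w) * pressure X \<phi>"
  define L where "L = (SUP y\<in>A. ennreal (exp (S y - c)))"
  define Q where "Q = (SUP y\<in>A. ereal (S y))"
  have "exp_ereal (Q - ereal c) = L"
  proof (rule antisym)
    show "L \<le> exp_ereal (Q - ereal c)"
      unfolding L_def
    proof (rule SUP_least)
      fix y assume "y \<in> A"
      then have "ereal (S y) \<le> Q" unfolding Q_def by (intro SUP_upper)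
      then have "exp_ereal (ereal (S y) - ereal c) \<le> exp_ereal (Q - ereal c)"
        by (intro exp_ereal_mono ereal_minus_mono) auto
      then show "ennreal (exp (S y - c)) \<le> exp_ereal (Q - ereal c)" by (simp add: exp_ereal_def)
    qed
    show "exp_ereal (Q - ereal c) \<le> L"
    proof (cases "A = {}")
      case True
      \<comment> \<open>If the leaf misses the cylinder, the supremum is negative infinity and
        \<open>exp_ereal\<close> sends it to 0.\<close>
      then show ?thesis by (simp add: Q_def bot_ereal_def exp_ereal_def)
    next
      case False
      then obtain y0 where y0: "y0 \<in> A" by auto
      have up: "ennreal (exp (S y - c)) \<le> L" if "y \<in> A" for y
        unfolding L_def using that by (intro SUP_upper)
      show ?thesis
      proof (cases L)
        case (real r)
        have r: "exp (S y - c) \<le> r" if "y \<in> A" for y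
          using up[OF that] real by simp
        then have "0 < r" using y0 by (meson exp_gt_zero less_le_trans)
        have "Q \<le> ereal (ln r + c)"
          unfolding Q_def
        proof (rule SUP_least)
          fix y assume "y \<in> A"
          then have "S y - c \<le> ln r" using r \<open>0 < r\<close> by (simp add: ln_ge_iff)
          then show "ereal (S y) \<le> ereal (ln r + c)" by simp
        qed
        then have "exp_ereal (Q - ereal c) \<le> exp_ereal (ereal (ln r + c) - ereal c)"
          by (intro exp_ereal_mono ereal_minus_mono) auto
        then show ?thesis using \<open>0 < r\<close> real by (simp add: exp_ereal_def)
      qed simp
    qed
  qed
  then show ?thesis by (simp add: leaf_weight_def Phi_plus_def L_def Q_def A_def S_def c_def)
qed

definition premu ::
  "'a biseq set \<Rightarrow> ('a biseq \<Rightarrow> real) \<Rightarrow> 'a biseq \<Rightarrow> 'a biseq set \<Rightarrow> nat \<Rightarrow> ennreal" where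
  "premu X \<phi> x Z N = (INF E\<in>covers X Z N. infsum (leaf_weight X \<phi> x) E)"

lemma covers_antimono: "M \<le> N \<Longrightarrow> covers X Z N \<subseteq> covers X Z M"
  by (auto simp: covers_def lang_ge_def)

text \<open>Requiring longer words leaves fewer covers, so the infima increase with \<open>N\<close>
  and the limit is a supremum, for an arbitrary set \<open>Z\<close>.\<close>

lemma mu_eq: "mu X \<phi> x Z = (SUP N. premu X \<phi> x Z N)"
proof -
  have "incseq (premu X \<phi> x Z)"
    unfolding premu_def by (intro incseq_SucI INF_superset_mono covers_antimono) auto
  then have "premu X \<phi> x Z \<longlonglongrightarrow> (SUP N. premu X \<phi> x Z N)" by (rule LIMSEQ_SUP)
  then show ?thesis
    unfolding mu_def exp_ereal_Phi_plus premu_def[symmetric] by (simp add: limI)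
qed

lemma premu_le_mu: "premu X \<phi> x Z N \<le> mu X \<phi> x Z"
  unfolding mu_eq by (intro SUP_upper) auto

lemma premu_le: "E \<in> covers X Z N \<Longrightarrow> premu X \<phi> x Z N \<le> infsum (leaf_weight X \<phi> x) E"
  unfolding premu_def by (intro INF_lower)

lemma mu_empty [simp]: "mu X \<phi> x {} = 0"
proof -
  have "premu X \<phi> x {} N = 0" for N
    using premu_le[of "{}" X "{}" N \<phi> x] by (simp add: covers_def)
  then show ?thesis by (simp add: mu_eq)
qed

lemma mu_mono: "Y \<subseteq> Z \<Longrightarrow> mu X \<phi> x Y \<le> mu X \<phi> x Z"
  unfolding mu_eq premu_def covers_def
  by (intro SUP_mono bexI[OF _ UNIV_I] INF_superset_mono) auto

text \<open>At a fixed scale \<open>N\<close>, covers of the \<open>Z i\<close> that are optimal up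
  to \<open>e / 2 ^ Suc i\<close> are united. Since \<open>premu\<close> never exceeds
  \<open>mu\<close>, the bound does not depend on \<open>N\<close>.\<close>

lemma mu_countably_subadditive: "mu X \<phi> x (\<Union>i. Z i) \<le> (\<Sum>i::nat. mu X \<phi> x (Z i))"
proof (rule ennreal_le_epsilon)
  fix e :: real assume e: "0 < e" and fin: "(\<Sum>i. mu X \<phi> x (Z i)) < top"
  have "premu X \<phi> x (\<Union>i. Z i) N \<le> (\<Sum>i. mu X \<phi> x (Z i)) + ennreal e" for N
  proof -
    have "\<exists>E\<in>covers X (Z i) N. infsum (leaf_weight X \<phi> x) E \<le> mu X \<phi> x (Z i) + ennreal (e * (1/2) ^ Suc i)" for i
    proof -
      \<comment> \<open>Finiteness of each term makes adding the positive error a strict increase,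
        so some cover lies below it.\<close>
      have "mu X \<phi> x (Z i) < top"
        using fin ennreal_suminf_lessD by blast
      then have "premu X \<phi> x (Z i) N < mu X \<phi> x (Z i) + ennreal (e * (1/2) ^ Suc i)"
        using e by (intro le_less_trans[OF premu_le_mu]) (auto simp: ennreal_add_left_cancel_less[of _ 0, simplified] ennreal_zero_less_mult_iff)
      then show ?thesis unfolding premu_def INF_less_iff by (auto intro: less_imp_le)
    qed
    then obtain E where E: "\<And>i. E i \<in> covers X (Z i) N"
      "\<And>i. infsum (leaf_weight X \<phi> x) (E i) \<le> mu X \<phi> x (Z i) + ennreal (e * (1/2) ^ Suc i)"
      by metis
    have "(\<Union>i. E i) \<in> covers X (\<Union>i. Z i) N"
      using E(1) unfolding covers_def by blast
    then have "premu X \<phi> x (\<Union>i. Z i) N \<le> infsum (leaf_weight X \<phi> x) (\<Union>i. E i)" by (rule premu_le)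
    also have "\<dots> \<le> (\<Sum>i. infsum (leaf_weight X \<phi> x) (E i))" by (rule infsum_UN_le_ennreal)
    also have "\<dots> \<le> (\<Sum>i. mu X \<phi> x (Z i) + ennreal (e * (1/2) ^ Suc i))"
      using E(2) by (intro suminf_le) auto
    also have "\<dots> = (\<Sum>i. mu X \<phi> x (Z i)) + (\<Sum>i. ennreal (e * (1/2) ^ Suc i))"
      by (intro suminf_add[symmetric]) auto
    also have "(\<Sum>i. ennreal (e * (1/2) ^ Suc i)) = ennreal (\<Sum>i. e * (1/2) ^ Suc i)"
      using e power_half_series by (intro suminf_ennreal2 summable_mult) (auto simp: sums_iff)
    also have "(\<Sum>i. e * (1/2) ^ Suc i) = e"
      using sums_unique[OF sums_mult[OF power_half_series, of e]] by simp
    finally show ?thesis .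
  qed
  then show "mu X \<phi> x (\<Union>i. Z i) \<le> (\<Sum>i. mu X \<phi> x (Z i)) + ennreal e"
    unfolding mu_eq[of X \<phi> x "\<Union>i. Z i"] by (intro SUP_least) auto
qed

lemma mu_Un_le: "mu X \<phi> x (A \<union> B) \<le> mu X \<phi> x A + mu X \<phi> x B"
proof -
  have "(\<Union>i::nat. if i = 0 then A else if i = 1 then B else {}) = A \<union> B"
    by (auto split: if_splits)
  moreover have "(\<Sum>i::nat. mu X \<phi> x (if i = 0 then A else if i = 1 then B else {})) = mu X \<phi> x A + mu X \<phi> x B"
    by (subst suminf_finite[of "{0,1}"]) auto
  ultimately show ?thesis
    using mu_countably_subadditive[of X \<phi> x "\<lambda>i. if i = 0 then A else if i = 1 then B else {}"] by simp
qed

lemma cyl_plus_nested: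
  assumes "length u \<le> length w" "cyl_plus X w \<inter> cyl_plus X u \<noteq> {}"
  shows "cyl_plus X w \<subseteq> cyl_plus X u"
  using assms unfolding cyl_plus_def by fastforce

text \<open>Covers by words longer than \<open>u\<close> split along \<open>[u]\<close>, so \<open>[u]\<close> satisfies Caratheodory's criterion.\<close>

lemma mu_split_cyl_plus:
  "mu X \<phi> x (Z \<inter> cyl_plus X u) + mu X \<phi> x (Z - cyl_plus X u) \<le> mu X \<phi> x Z"
proof -
  let ?C = "cyl_plus X u"
  have *: "premu X \<phi> x (Z \<inter> ?C) N + premu X \<phi> x (Z - ?C) N \<le> premu X \<phi> x Z (max N (length u))" for N
    unfolding premu_def[of X \<phi> x Z]
  proof (rule INF_greatest)
    fix E assume E: "E \<in> covers X Z (max N (length u))"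
    define E1 where "E1 = {w\<in>E. cyl_plus X w \<inter> ?C \<noteq> {}}"
    have len: "length u \<le> length w" if "w \<in> E" for w
      using E that by (auto simp: covers_def lang_ge_def)
    have "E1 \<in> covers X (Z \<inter> ?C) N"
      using E unfolding covers_def E1_def lang_ge_def by fastforce
    moreover have "E - E1 \<in> covers X (Z - ?C) N"
      using E cyl_plus_nested[OF len] unfolding covers_def E1_def lang_ge_def by fastforce
    ultimately have "premu X \<phi> x (Z \<inter> ?C) N + premu X \<phi> x (Z - ?C) N
        \<le> infsum (leaf_weight X \<phi> x) E1 + infsum (leaf_weight X \<phi> x) (E - E1)"
      by (intro add_mono premu_le)
    also have "\<dots> = infsum (leaf_weight X \<phi> x) (E1 \<union> (E - E1))"
      by (intro infsum_Un_disjoint[symmetric] nonneg_summable_on_complete) auto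
    also have "E1 \<union> (E - E1) = E" by (auto simp: E1_def)
    finally show "premu X \<phi> x (Z \<inter> ?C) N + premu X \<phi> x (Z - ?C) N \<le> infsum (leaf_weight X \<phi> x) E" .
  qed
  have inc: "incseq (premu X \<phi> x Y)" for Y
    unfolding premu_def by (intro incseq_SucI INF_superset_mono covers_antimono) auto
  \<comment> \<open>Both sequences increase in \<open>N\<close>, so the sum of the suprema is the
    supremum of the sums.\<close>
  have "mu X \<phi> x (Z \<inter> ?C) + mu X \<phi> x (Z - ?C) = (SUP N. premu X \<phi> x (Z \<inter> ?C) N + premu X \<phi> x (Z - ?C) N)"
    unfolding mu_eq by (intro ennreal_SUP_add[symmetric] inc)
  also have "\<dots> \<le> mu X \<phi> x Z"
    using * premu_le_mu by (intro SUP_least) (rule order_trans)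
  finally show ?thesis .
qed

text \<open>The off-by-one matches \<open>bidist_agree\<close>: agreement strictly inside radius
  \<open>k\<close> gives distance at most \<open>(1/2) ^ k\<close>, whereas distance strictly below
  \<open>(1/2) ^ k\<close> gives agreement up to and including radius \<open>k\<close>.\<close>

lemma bidist_le:
  assumes "\<And>n. nat \<bar>n\<bar> < k \<Longrightarrow> x n = y n"
  shows "bidist x y \<le> (1/2) ^ k"
proof (cases "x = y")
  case False
  define l where "l = (LEAST k. \<exists>n. nat \<bar>n\<bar> = k \<and> x n \<noteq> y n)"
  obtain n0 where "x n0 \<noteq> y n0" using False by (meson ext)
  then have "\<exists>n. nat \<bar>n\<bar> = l \<and> x n \<noteq> y n"
    unfolding l_def by (intro LeastI[of "\<lambda>k. \<exists>n. nat \<bar>n\<bar> = k \<and> x n \<noteq> y n"]) blast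
  then have "k \<le> l" using assms by (metis not_less)
  then have "(1/2::real) ^ l \<le> (1/2) ^ k" by (intro power_decreasing) auto
  then show ?thesis using False by (simp add: bidist_def l_def)
qed (simp add: bidist_def)

text \<open>This trades the metric for finite coordinate windows, the language in which Borel sets,
  compactness and continuity are treated below.\<close>

lemma openin_bitop_iff:
  "openin bitop U \<longleftrightarrow> (\<forall>x\<in>U. \<exists>k. \<forall>y. (\<forall>n. nat \<bar>n\<bar> \<le> k \<longrightarrow> x n = y n) \<longrightarrow> y \<in> U)"
    (is "_ \<longleftrightarrow> ?R")
proof -
  interpret Metric_space UNIV bidist by (rule Metric_space_bidist)
  show ?thesis
  proof
    assume U: "openin bitop U"
    show ?R
    proof
      fix x assume "x \<in> U"
      then obtain r where r: "r > 0" "mball x r \<subseteq> U"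
        using U by (auto simp: openin_mtopology)
      obtain k where k: "(1/2::real) ^ k < r" using r(1) by (metis one_less_numeral_iff real_arch_pow_inv semiring_norm(76) half_gt_zero_iff divide_less_eq_1_pos zero_less_numeral)
      have "y \<in> U" if "\<forall>n. nat \<bar>n\<bar> \<le> k \<longrightarrow> x n = y n" for y
        using bidist_le[of k x y] that k r(2) by (fastforce simp: mball_def)
      then show "\<exists>k. \<forall>y. (\<forall>n. nat \<bar>n\<bar> \<le> k \<longrightarrow> x n = y n) \<longrightarrow> y \<in> U" by blast
    qed
  next
    assume R: ?R
    show "openin bitop U"
      unfolding openin_mtopology
    proof (intro conjI allI impI)
      fix x assume "x \<in> U"
      then obtain k where k: "\<And>y. (\<forall>n. nat \<bar>n\<bar> \<le> k \<longrightarrow> x n = y n) \<Longrightarrow> y \<in> U" using R by blast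
      have "mball x ((1/2) ^ k) \<subseteq> U"
        using k bidist_agree[of x _ k] by (fastforce simp: mball_def)
      then show "\<exists>r>0. mball x r \<subseteq> U" by (meson half_gt_zero_iff zero_less_one zero_less_power)
    qed simp
  qed
qed

section \<open>Borel sets of a leaf\<close>

lemma cyl_plus_subset: "cyl_plus X u \<subseteq> X"
  by (auto simp: cyl_plus_def)

lemma Wu_subset: "Wu X R x \<subseteq> X"
  by (auto simp: Wu_def Wu_loc_def)

text \<open>Over a finite alphabet there are only countably many words, so any union of leaf
  cylinders is a countable one.\<close>

lemma sigma_sets_cylindersI:
  fixes X :: "('a::finite) biseq set"
  assumes "A \<subseteq> W" and "\<And>x. x \<in> A \<Longrightarrow> \<exists>u. x \<in> cyl_plus X u \<and> W \<inter> cyl_plus X u \<subseteq> A"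
  shows "A \<in> sigma_sets W (range (\<lambda>u. W \<inter> cyl_plus X u))"
proof -
  interpret sigma_algebra W "sigma_sets W (range (\<lambda>u. W \<inter> cyl_plus X u))"
    by (rule sigma_algebra_sigma_sets) auto
  have eq: "(\<Union>u\<in>{u. W \<inter> cyl_plus X u \<subseteq> A}. W \<inter> cyl_plus X u) = A"
    using assms by blast
  have "countable {u. W \<inter> cyl_plus X u \<subseteq> A}" by (rule countableI_type)
  then have "(\<Union>u\<in>{u. W \<inter> cyl_plus X u \<subseteq> A}. W \<inter> cyl_plus X u)
      \<in> sigma_sets W (range (\<lambda>u. W \<inter> cyl_plus X u))"
    by (rule countable_UN'') (rule sigma_sets.Basic, rule rangeI)
  then show ?thesis unfolding eq .
qed

definition prefix :: "nat \<Rightarrow> 'a biseq \<Rightarrow> 'a list" where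
  "prefix k x = map (\<lambda>i. x (int i)) [0..<k]"

lemma length_prefix [simp]: "length (prefix k x) = k"
  by (simp add: prefix_def)

lemma in_cyl_prefix_iff: "z \<in> cyl_plus X (prefix k x) \<longleftrightarrow> z \<in> X \<and> (\<forall>i<k. z (int i) = x (int i))"
  by (simp add: cyl_plus_def prefix_def)

text \<open>On an unstable leaf the symmetric window of radius \<open>k\<close> is a cylinder of length \<open>k + 1\<close>.\<close>

lemma cyl_prefix_agree:
  assumes "z \<in> Wu_loc X x \<inter> cyl_plus X (prefix (Suc k) y)" "y \<in> Wu_loc X x" "n \<le> int k"
  shows "y n = z n"
proof (cases "n \<le> 0")
  case False
  then have "nat n < Suc k" "int (nat n) = n" using assms(3) by auto
  moreover have "z (int i) = y (int i)" if "i < Suc k" for i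
    using assms(1) that by (simp add: in_cyl_prefix_iff)
  ultimately show ?thesis by metis
qed (use assms in \<open>simp add: Wu_loc_def\<close>)

text \<open>The past is constant on an unstable leaf, so the one-sided cylinders are a base of its
  topology. As generators they are the sets for which Caratheodory's criterion is available.\<close>

lemma sigma_sets_leaf:
  fixes X :: "('a::finite) biseq set"
  shows "sigma_sets (Wu X R x) {U. openin (subtopology bitop (Wu X R x)) U} =
    sigma_sets (Wu X R x) (range (\<lambda>u. Wu X R x \<inter> cyl_plus X u))" (is "sigma_sets ?W _ = sigma_sets _ ?C")
proof (rule sigma_sets_eqI)
  fix U assume "U \<in> {U. openin (subtopology bitop ?W) U}"
  then obtain S where S: "openin bitop S" "U = S \<inter> ?W" by (auto simp: openin_subtopology)
  show "U \<in> sigma_sets ?W ?C"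
  proof (rule sigma_sets_cylindersI)
    fix y assume y: "y \<in> U"
    then obtain k where k: "\<And>z. (\<forall>n. nat \<bar>n\<bar> \<le> k \<longrightarrow> y n = z n) \<Longrightarrow> z \<in> S"
      using S openin_bitop_iff[of S] by blast
    have yW: "y \<in> Wu_loc X x" using y S(2) by (simp add: Wu_def)
    have "?W \<inter> cyl_plus X (prefix (Suc k) y) \<subseteq> U"
    proof
      fix z assume z: "z \<in> ?W \<inter> cyl_plus X (prefix (Suc k) y)"
      have "y n = z n" if "nat \<bar>n\<bar> \<le> k" for n
        using that z yW by (intro cyl_prefix_agree[of z X x k]) (auto simp: Wu_def)
      then show "z \<in> U" using k z S(2) by blast
    qed
    moreover have "y \<in> cyl_plus X (prefix (Suc k) y)"
      using yW by (simp add: in_cyl_prefix_iff Wu_loc_def)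
    ultimately show "\<exists>u. y \<in> cyl_plus X u \<and> ?W \<inter> cyl_plus X u \<subseteq> U" by blast
  qed (use S in simp)
next
  fix U assume "U \<in> ?C"
  then obtain u where u: "U = ?W \<inter> cyl_plus X u" by auto
  \<comment> \<open>The same coordinate constraints, imposed on all sequences rather than on
    \<open>X\<close>, give an open set whose trace on the leaf is the cylinder.\<close>
  define S where "S = {y :: 'a biseq. \<forall>i<length u. y (int i) = u ! i}"
  have "\<forall>z. (\<forall>n. nat \<bar>n\<bar> \<le> length u \<longrightarrow> y n = z n) \<longrightarrow> z \<in> S" if "y \<in> S" for y
  proof (intro allI impI)
    fix z assume "\<forall>n. nat \<bar>n\<bar> \<le> length u \<longrightarrow> y n = z n"
    then have "y (int i) = z (int i)" if "i < length u" for i using that by auto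
    then show "z \<in> S" using \<open>y \<in> S\<close> by (auto simp: S_def)
  qed
  then have "openin bitop S" unfolding openin_bitop_iff by blast
  moreover have "U = S \<inter> ?W" using Wu_subset[of X R x] by (auto simp: u S_def cyl_plus_def)
  ultimately show "U \<in> sigma_sets ?W {U. openin (subtopology bitop ?W) U}"
    by (intro sigma_sets.Basic) (auto simp: openin_subtopology)
qed

lemma openin_leaf_Pow: "{U. openin (subtopology bitop W) U} \<subseteq> Pow W"
  using openin_subset by fastforce

lemma space_leaf_measure [simp]: "space (leaf_measure X \<phi> R x) = Wu X R x"
  unfolding leaf_measure_def using openin_leaf_Pow by (rule space_measure_of)

lemma sets_leaf_measure:
  fixes X :: "('a::finite) biseq set"
  shows "sets (leaf_measure X \<phi> R x) = sigma_sets (Wu X R x) (range (\<lambda>u. Wu X R x \<inter> cyl_plus X u))"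
  unfolding leaf_measure_def sets_measure_of[OF openin_leaf_Pow] by (rule sigma_sets_leaf)

lemma cyl_in_sets_leaf [intro, simp]:
  fixes X :: "('a::finite) biseq set"
  shows "Wu X R x \<inter> cyl_plus X u \<in> sets (leaf_measure X \<phi> R x)"
  unfolding sets_leaf_measure by auto

text \<open>\<open>measure_of\<close> returns the given set function only when that function is a
  measure. The Caratheodory sets of \<open>mu\<close>, taken among all subsets of the leaf, contain
  every leaf cylinder and hence the Borel sets, and \<open>mu\<close> is countably additive on
  them.\<close>

lemma emeasure_leaf_measure:
  fixes X :: "('a::finite) biseq set"
  assumes "Y \<in> sets (leaf_measure X \<phi> R x)"
  shows "emeasure (leaf_measure X \<phi> R x) Y = mu X \<phi> x Y"
proof -
  let ?W = "Wu X R x" and ?m = "mu X \<phi> x"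
  interpret sigma_algebra ?W "Pow ?W" by (rule sigma_algebra_Pow)
  have oms: "outer_measure_space (Pow ?W) ?m"
    unfolding outer_measure_space_def positive_def increasing_def countably_subadditive_def
    by (simp add: mu_countably_subadditive mu_mono)
  define L where "L = lambda_system ?W (Pow ?W) ?m"
  have L: "measure_space ?W L ?m" unfolding L_def by (rule caratheodory_lemma[OF oms])
  have "?W \<inter> cyl_plus X u \<in> L" for u
    unfolding L_def lambda_system_eq
  proof (intro CollectI conjI ballI)
    fix Z assume "Z \<in> Pow ?W"
    then have *: "Z \<inter> (?W \<inter> cyl_plus X u) = Z \<inter> cyl_plus X u" "Z - ?W \<inter> cyl_plus X u = Z - cyl_plus X u"
      by auto
    have "?m Z \<le> ?m (Z \<inter> cyl_plus X u) + ?m (Z - cyl_plus X u)"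
      using mu_Un_le[of X \<phi> x "Z \<inter> cyl_plus X u" "Z - cyl_plus X u"] by (simp add: Int_Diff_Un)
    then show "?m (Z \<inter> (?W \<inter> cyl_plus X u)) + ?m (Z - ?W \<inter> cyl_plus X u) = ?m Z"
      unfolding * using mu_split_cyl_plus[of X \<phi> x Z u] by (rule antisym[rotated])
  qed auto
  then have sub: "sets (leaf_measure X \<phi> R x) \<subseteq> L"
    unfolding sets_leaf_measure using L
    by (intro sigma_algebra.sigma_sets_subset image_subsetI) (simp_all add: measure_space_def)
  show ?thesis
  proof (rule emeasure_measure_of[OF leaf_measure_def])
    show "countably_additive (sets (leaf_measure X \<phi> R x)) ?m"
    proof (rule countably_additiveI)
      fix A :: "nat \<Rightarrow> 'a biseq set"
      assume "range A \<subseteq> sets (leaf_measure X \<phi> R x)" and dis: "disjoint_family A"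
        and "(\<Union>i. A i) \<in> sets (leaf_measure X \<phi> R x)"
      then have "range A \<subseteq> L" "(\<Union>i. A i) \<in> L" using sub by blast+
      moreover have "countably_additive L ?m" using L by (simp add: measure_space_def)
      ultimately show "(\<Sum>i. ?m (A i)) = ?m (\<Union>i. A i)"
        using dis by (simp add: countably_additive_def)
    qed
  qed (use assms openin_leaf_Pow in \<open>simp_all add: positive_def\<close>)
qed

lemma lang_ge_iff: "w \<in> lang_ge X N \<longleftrightarrow> cyl_plus X w \<noteq> {} \<and> N \<le> length w"
  by (auto simp: lang_ge_def lang_def)

section \<open>Scaling under the shift\<close>

locale invariant_set =
  fixes X :: "('a::finite) biseq set" and \<phi> :: "'a biseq \<Rightarrow> real"
  assumes shift_X: "shift ` X = X"
begin

lemma shift_funpow_image: "(shift ^^ n) ` X = X"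
proof (induction n)
  case (Suc n)
  then show ?case using shift_X by (simp only: funpow.simps image_comp[symmetric])
qed simp

lemma shift_mem [simp]: "(shift ^^ n) x \<in> X \<longleftrightarrow> x \<in> X"
proof
  assume "(shift ^^ n) x \<in> X"
  then obtain y where "y \<in> X" "(shift ^^ n) x = (shift ^^ n) y"
    using shift_funpow_image[of n] by blast
  then show "x \<in> X" using injD[OF inj_shift_funpow, of n x y] by simp
qed (use shift_funpow_image[of n] in blast)

lemma unshift_mem [simp]: "unshift n x \<in> X \<longleftrightarrow> x \<in> X"
  using shift_mem[of n "unshift n x"] by simp

lemma cyl_plus_split:
  assumes "n \<le> length w"
  shows "z \<in> cyl_plus X w \<longleftrightarrow> (\<forall>i<n. z (int i) = w ! i) \<and> (shift ^^ n) z \<in> cyl_plus X (drop n w)"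
proof -
  have shift_nth: "(shift ^^ n) z (int i) = z (int (i + n))" for i
    by (simp add: shift_funpow)
  show ?thesis
  proof
    assume z: "z \<in> cyl_plus X w"
    then have "z (int i) = w ! i" if "i < length w" for i
      using that by (simp add: cyl_plus_def)
    moreover from this have "z (int (i + n)) = w ! (n + i)" if "i < length w - n" for i
      using that by (simp only: add.commute[of n] less_diff_conv)
    ultimately show "(\<forall>i<n. z (int i) = w ! i) \<and> (shift ^^ n) z \<in> cyl_plus X (drop n w)"
      using assms z by (simp add: cyl_plus_def shift_nth del: of_nat_add)
  next
    assume r: "(\<forall>i<n. z (int i) = w ! i) \<and> (shift ^^ n) z \<in> cyl_plus X (drop n w)"
    then have r2: "z (int (i + n)) = w ! (n + i)" if "i < length w - n" for i
      using that assms by (simp add: cyl_plus_def shift_nth del: of_nat_add)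
    have "z (int i) = w ! i" if "i < length w" for i
    proof (cases "i < n")
      case False
      then show ?thesis using r2[of "i - n"] that by simp
    qed (use r in blast)
    then show "z \<in> cyl_plus X w" using r by (simp add: cyl_plus_def)
  qed
qed

text \<open>The nonpositive coordinates after \<open>n\<close> shifts are the old coordinates up to
  and including \<open>n\<close>. Those beyond 0 are dictated by \<open>u\<close>, which is why
  \<open>u\<close> must have at least \<open>n + 1\<close> letters.\<close>

lemma shift_Wu_loc:
  assumes "n < length u" "x0 \<in> Wu_loc X x \<inter> cyl_plus X u"
    "y \<in> Wu_loc X x" "\<And>i. i \<le> n \<Longrightarrow> y (int i) = u ! i"
  shows "(shift ^^ n) y \<in> Wu_loc X ((shift ^^ n) x0)"
proof -
  have "y (k + int n) = x0 (k + int n)" if "k \<le> 0" for k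
  proof (cases "k + int n \<le> 0")
    case False
    define i where "i = nat (k + int n)"
    then have i: "k + int n = int i" "i \<le> n" using that False by auto
    moreover have "x0 (int i) = u ! i"
      using assms(1,2) i by (auto simp: cyl_plus_def)
    ultimately show ?thesis using assms(4)[of i] by simp
  qed (use assms(2,3) in \<open>auto simp: Wu_loc_def\<close>)
  then have "(shift ^^ n) y k = (shift ^^ n) x0 k" if "k \<le> 0" for k
    using that by (simp add: shift_funpow)
  moreover have "(shift ^^ n) y \<in> X" using assms(3) by (simp add: Wu_loc_def)
  ultimately show ?thesis unfolding Wu_loc_def by blast
qed

text \<open>The factor \<open>exp (birkhoff \<phi> n y - n * P)\<close> is what the word weights lose when \<open>n\<close> symbols
  are removed in front.\<close>

lemma mu_le_shift:
  assumes n: "n < length u" and x0: "x0 \<in> Wu_loc X x \<inter> cyl_plus X u"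
    and Z: "Z \<subseteq> Wu_loc X x \<inter> cyl_plus X u"
    and b: "\<And>y. y \<in> Wu_loc X x \<inter> cyl_plus X u \<Longrightarrow> birkhoff \<phi> n y \<le> b"
  shows "mu X \<phi> x Z \<le> ennreal (exp (b - real n * pressure X \<phi>)) * mu X \<phi> ((shift ^^ n) x0) ((shift ^^ n) ` Z)"
proof -
  let ?P = "pressure X \<phi>" and ?x' = "(shift ^^ n) x0" and ?Z' = "(shift ^^ n) ` Z"
  have main: "premu X \<phi> x Z N \<le> ennreal (exp (b - real n * ?P)) * infsum (leaf_weight X \<phi> ?x') E"
    if E: "E \<in> covers X ?Z' (max N (length u))" for N E
  proof -
    \<comment> \<open>Each word of \<open>E\<close> gets the first \<open>n\<close> letters of
      \<open>u\<close> in front. Words missing \<open>Z\<close> are discarded: the others are longer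
      than \<open>u\<close>, by the choice of scale, and meet \<open>cyl_plus X u\<close>, so they
      lie inside it, where the bound \<open>b\<close> applies.\<close>
    define E' where "E' = {w. take n w = take n u \<and> drop n w \<in> E \<and> Z \<inter> cyl_plus X w \<noteq> {}}"
    have len: "n \<le> length w" "max N (length u) \<le> length w - n" if "w \<in> E'" for w
    proof -
      have "length (take n w) = n" using that n by (simp add: E'_def)
      then show "n \<le> length w" by simp
      show "max N (length u) \<le> length w - n"
        using that E by (auto simp: E'_def covers_def lang_ge_iff)
    qed
    have "E' \<in> covers X Z N"
      unfolding covers_def
    proof (intro CollectI conjI subsetI)
      fix w assume w: "w \<in> E'"
      then show "w \<in> lang_ge X N" using len[OF w] by (auto simp: lang_ge_iff E'_def)
    next
      fix z assume z: "z \<in> Z"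
      then obtain v where v: "v \<in> E" "(shift ^^ n) z \<in> cyl_plus X v"
        using E by (auto simp: covers_def)
      have "z \<in> cyl_plus X (take n u @ v)"
        using v z Z n by (subst cyl_plus_split[of n]) (auto simp: cyl_plus_def nth_append)
      moreover from this have "take n u @ v \<in> E'" using v z n by (auto simp: E'_def)
      ultimately show "z \<in> (\<Union>w\<in>E'. cyl_plus X w)" by blast
    qed
    then have "premu X \<phi> x Z N \<le> infsum (leaf_weight X \<phi> x) E'" by (rule premu_le)
    also have "\<dots> \<le> ennreal (exp (b - real n * ?P)) * infsum (leaf_weight X \<phi> ?x') E"
    proof (rule infsum_le_reindex_ennreal[of "drop n"])
      show "inj_on (drop n) E'" unfolding E'_def by (rule inj_onI) (metis (mono_tags, lifting) append_take_drop_id mem_Collect_eq)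
      show "drop n ` E' \<subseteq> E" by (auto simp: E'_def)
      fix w assume w: "w \<in> E'"
      have sub: "cyl_plus X w \<subseteq> cyl_plus X u"
        using w Z len[OF w] by (intro cyl_plus_nested) (auto simp: E'_def)
      show "leaf_weight X \<phi> x w \<le> ennreal (exp (b - real n * ?P)) * leaf_weight X \<phi> ?x' (drop n w)"
        unfolding leaf_weight_def[of X \<phi> x]
      proof (rule SUP_least)
        fix y assume y: "y \<in> Wu_loc X x \<inter> cyl_plus X w"
        let ?l = "length w - n"
        have y': "(shift ^^ n) y \<in> Wu_loc X ?x' \<inter> cyl_plus X (drop n w)"
          using y sub n x0 cyl_plus_split[of n w y] len[OF w]
          by (auto intro!: shift_Wu_loc[of n u] simp: cyl_plus_def subset_iff)
        have "birkhoff \<phi> (length w) y = birkhoff \<phi> n y + birkhoff \<phi> ?l ((shift ^^ n) y)"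
          using birkhoff_add[of \<phi> n ?l y] len[OF w] by simp
        moreover have "real (length w) * ?P = real n * ?P + real ?l * ?P"
          using len[OF w] by (simp add: algebra_simps of_nat_diff)
        ultimately have "birkhoff \<phi> (length w) y - real (length w) * ?P
            \<le> (b - real n * ?P) + (birkhoff \<phi> ?l ((shift ^^ n) y) - real ?l * ?P)"
          using b[of y] y sub by auto
        then have "ennreal (exp (birkhoff \<phi> (length w) y - real (length w) * ?P))
            \<le> ennreal (exp (b - real n * ?P)) * ennreal (exp (birkhoff \<phi> ?l ((shift ^^ n) y) - real ?l * ?P))"
          by (simp add: ennreal_mult[symmetric] exp_add[symmetric] ennreal_leI)
        also have "\<dots> \<le> ennreal (exp (b - real n * ?P)) * leaf_weight X \<phi> ?x' (drop n w)"
          unfolding leaf_weight_def length_drop using y' by (intro mult_left_mono SUP_upper) auto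
        finally show "ennreal (exp (birkhoff \<phi> (length w) y - real (length w) * ?P))
            \<le> ennreal (exp (b - real n * ?P)) * leaf_weight X \<phi> ?x' (drop n w)" .
      qed
    qed
    finally show ?thesis .
  qed
  have "premu X \<phi> x Z N \<le> ennreal (exp (b - real n * ?P)) * mu X \<phi> ?x' ?Z'" for N
  proof -
    have "premu X \<phi> x Z N \<le> ennreal (exp (b - real n * ?P)) * premu X \<phi> ?x' ?Z' (max N (length u))"
      unfolding premu_def[of X \<phi> ?x'] by (intro ennreal_le_exp_INF main)
    also have "\<dots> \<le> ennreal (exp (b - real n * ?P)) * mu X \<phi> ?x' ?Z'"
      by (intro mult_left_mono premu_le_mu) auto
    finally show ?thesis .
  qed
  then show ?thesis unfolding mu_eq[of X \<phi> x Z] by (intro SUP_least)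
qed

text \<open>The reverse comparison: a cover of \<open>Z\<close> yields one of the image by deleting
  the first \<open>n\<close> letters, and points of the shifted leaf are pulled back to bound the
  weights. The scale \<open>N + length u\<close> leaves words of length at least \<open>N\<close>
  after the deletion.\<close>

lemma mu_shift_le:
  assumes n: "n < length u" and x0: "x0 \<in> Wu_loc X x \<inter> cyl_plus X u"
    and Z: "Z \<subseteq> Wu_loc X x \<inter> cyl_plus X u"
    and a: "\<And>y. y \<in> Wu_loc X x \<inter> cyl_plus X u \<Longrightarrow> a \<le> birkhoff \<phi> n y"
  shows "mu X \<phi> ((shift ^^ n) x0) ((shift ^^ n) ` Z) \<le> ennreal (exp (real n * pressure X \<phi> - a)) * mu X \<phi> x Z"
proof -
  let ?P = "pressure X \<phi>" and ?x' = "(shift ^^ n) x0" and ?Z' = "(shift ^^ n) ` Z"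
  have main: "premu X \<phi> ?x' ?Z' N \<le> ennreal (exp (real n * ?P - a)) * infsum (leaf_weight X \<phi> x) E"
    if E: "E \<in> covers X Z (N + length u)" for N E
  proof -
    define E' where "E' = {v. take n u @ v \<in> E \<and> Z \<inter> cyl_plus X (take n u @ v) \<noteq> {}}"
    have len: "N + length u \<le> n + length v" if "v \<in> E'" for v
    proof -
      have "take n u @ v \<in> E" using that by (simp add: E'_def)
      then have "N + length u \<le> length (take n u @ v)" using E by (auto simp: covers_def lang_ge_iff)
      then show ?thesis using n by simp
    qed
    have tail: "(shift ^^ n) z \<in> cyl_plus X v" if "z \<in> cyl_plus X (take n u @ v)" for z v
    proof -
      have "(shift ^^ n) z \<in> cyl_plus X (drop n (take n u @ v))"
        using that n cyl_plus_split[of n "take n u @ v" z] by auto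
      then show ?thesis using n by simp
    qed
    have "E' \<in> covers X ?Z' N"
      unfolding covers_def
    proof (intro CollectI conjI subsetI)
      fix v assume v: "v \<in> E'"
      then obtain z where "z \<in> cyl_plus X (take n u @ v)" by (auto simp: E'_def)
      then have "cyl_plus X v \<noteq> {}" using tail by blast
      then show "v \<in> lang_ge X N" using len[OF v] n by (simp add: lang_ge_iff)
    next
      fix z' assume "z' \<in> ?Z'"
      then obtain z where z: "z \<in> Z" "z' = (shift ^^ n) z" by auto
      then obtain w where w: "w \<in> E" "z \<in> cyl_plus X w" using E by (auto simp: covers_def)
      have l: "length u \<le> length w" using w E by (auto simp: covers_def lang_ge_iff)
      have "take n w = take n u"
        using w(2) z(1) Z l n by (intro nth_equalityI) (auto simp: cyl_plus_def subset_iff)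
      then have w': "take n u @ drop n w = w" by (metis append_take_drop_id)
      then have "drop n w \<in> E'" using w z by (auto simp: E'_def)
      moreover have "z' \<in> cyl_plus X (drop n w)" using tail w w' z by metis
      ultimately show "z' \<in> (\<Union>v\<in>E'. cyl_plus X v)" by blast
    qed
    then have "premu X \<phi> ?x' ?Z' N \<le> infsum (leaf_weight X \<phi> ?x') E'" by (rule premu_le)
    also have "\<dots> \<le> ennreal (exp (real n * ?P - a)) * infsum (leaf_weight X \<phi> x) E"
    proof (rule infsum_le_reindex_ennreal[of "\<lambda>v. take n u @ v"])
      show "inj_on (\<lambda>v. take n u @ v) E'" by (auto intro: inj_onI)
      show "(\<lambda>v. take n u @ v) ` E' \<subseteq> E" by (auto simp: E'_def)
      fix v assume v: "v \<in> E'"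
      let ?w = "take n u @ v"
      have lw: "length ?w = n + length v" using n by simp
      have sub: "cyl_plus X ?w \<subseteq> cyl_plus X u"
        using v Z len[OF v] n by (intro cyl_plus_nested) (auto simp: E'_def)
      show "leaf_weight X \<phi> ?x' v \<le> ennreal (exp (real n * ?P - a)) * leaf_weight X \<phi> x ?w"
        unfolding leaf_weight_def[of X \<phi> ?x']
      proof (rule SUP_least)
        fix y' assume y': "y' \<in> Wu_loc X ?x' \<inter> cyl_plus X v"
        \<comment> \<open>The leaf condition on \<open>y'\<close> at coordinates up to 0 becomes
          agreement of \<open>y\<close> with \<open>x0\<close> up to \<open>n\<close>. This puts
          \<open>y\<close> on the leaf of \<open>x\<close> and also gives it the first
          \<open>n\<close> letters of \<open>u\<close>.\<close>
        define y where "y = unshift n y'"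
        have agree: "y k = x0 k" if "k \<le> int n" for k
        proof -
          have "y' (k - int n) = ?x' (k - int n)" using y' that by (auto simp: Wu_loc_def)
          then show ?thesis by (simp add: y_def unshift_def shift_funpow)
        qed
        have "y \<in> X" using y' by (simp add: y_def Wu_loc_def)
        moreover have "y \<in> cyl_plus X ?w"
        proof (subst cyl_plus_split[of n], safe)
          show "y (int i) = ?w ! i" if "i < n" for i
            using that n x0 agree[of "int i"] by (auto simp: cyl_plus_def nth_append)
          show "(shift ^^ n) y \<in> cyl_plus X (drop n ?w)"
            using n y' by (simp add: y_def)
        qed (use n in simp)
        ultimately have y: "y \<in> Wu_loc X x \<inter> cyl_plus X ?w"
          using agree x0 by (auto simp: Wu_loc_def)
        have "birkhoff \<phi> (length ?w) y = birkhoff \<phi> n y + birkhoff \<phi> (length v) y'"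
          unfolding lw birkhoff_add by (simp add: y_def)
        moreover have "real (length ?w) * ?P = real n * ?P + real (length v) * ?P"
          unfolding lw by (simp add: algebra_simps)
        ultimately have "birkhoff \<phi> (length v) y' - real (length v) * ?P
            \<le> (real n * ?P - a) + (birkhoff \<phi> (length ?w) y - real (length ?w) * ?P)"
          using a[of y] y sub by auto
        then have "ennreal (exp (birkhoff \<phi> (length v) y' - real (length v) * ?P))
            \<le> ennreal (exp (real n * ?P - a)) * ennreal (exp (birkhoff \<phi> (length ?w) y - real (length ?w) * ?P))"
          by (simp only: ennreal_mult[symmetric] exp_add[symmetric] exp_ge_zero ennreal_leI exp_le_cancel_iff)
        also have "\<dots> \<le> ennreal (exp (real n * ?P - a)) * leaf_weight X \<phi> x ?w"
          unfolding leaf_weight_def using y by (intro mult_left_mono SUP_upper) auto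
        finally show "ennreal (exp (birkhoff \<phi> (length v) y' - real (length v) * ?P))
            \<le> ennreal (exp (real n * ?P - a)) * leaf_weight X \<phi> x ?w" .
      qed
    qed
    finally show ?thesis .
  qed
  have "premu X \<phi> ?x' ?Z' N \<le> ennreal (exp (real n * ?P - a)) * mu X \<phi> x Z" for N
  proof -
    have "premu X \<phi> ?x' ?Z' N \<le> ennreal (exp (real n * ?P - a)) * premu X \<phi> x Z (N + length u)"
      unfolding premu_def[of X \<phi> x] by (intro ennreal_le_exp_INF main)
    also have "\<dots> \<le> ennreal (exp (real n * ?P - a)) * mu X \<phi> x Z"
      by (intro mult_left_mono premu_le_mu) auto
    finally show ?thesis .
  qed
  then show ?thesis unfolding mu_eq[of X \<phi> ?x'] by (intro SUP_least)
qed

end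

section \<open>Compactness\<close>

text \<open>Tychonoff's theorem gives compactness in the product topology, and the identity into
  \<open>bitop\<close> is continuous because a window restricts only finitely many
  coordinates.\<close>

lemma compactin_bitop: "compactin (bitop :: ('a::finite) biseq topology) UNIV"
proof -
  let ?T = "product_topology (\<lambda>_::int. discrete_topology (UNIV :: 'a set)) UNIV"
  have "compact_space ?T"
    by (simp add: compact_space_product_topology compact_space_discrete_topology)
  then have "compactin ?T UNIV" by (simp add: compact_space_def)
  moreover have "continuous_map ?T bitop id"
    unfolding continuous_map_def
  proof (intro conjI allI impI)
    fix U :: "'a biseq set" assume U: "openin bitop U"
    have "openin ?T U"
      unfolding openin_product_topology_alt
    proof (intro conjI ballI)
      fix x assume "x \<in> U"
      then obtain k where k: "\<And>y. (\<forall>n. nat \<bar>n\<bar> \<le> k \<longrightarrow> x n = y n) \<Longrightarrow> y \<in> U"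
        using U openin_bitop_iff[of U] by blast
      define V where "V i = (if nat \<bar>i\<bar> \<le> k then {x i} else UNIV)" for i :: int
      have "{i. V i \<noteq> UNIV} \<subseteq> {- int k..int k}" by (auto simp: V_def split: if_splits)
      then have "finite {i. V i \<noteq> UNIV}" by (rule finite_subset) simp
      moreover have "Pi\<^sub>E UNIV V \<subseteq> U"
      proof
        fix y assume "y \<in> Pi\<^sub>E UNIV V"
        then have "y n \<in> V n" for n by (simp add: PiE_iff)
        then have "x n = y n" if "nat \<bar>n\<bar> \<le> k" for n
          using that unfolding V_def by (metis singletonD)
        then show "y \<in> U" using k by blast
      qed
      moreover have "x \<in> Pi\<^sub>E UNIV V" by (simp add: PiE_iff V_def)
      ultimately show "\<exists>V. finite {i \<in> UNIV. V i \<noteq> topspace (discrete_topology (UNIV :: 'a set))} \<and>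
          (\<forall>i\<in>UNIV. openin (discrete_topology UNIV) (V i)) \<and> x \<in> Pi\<^sub>E UNIV V \<and> Pi\<^sub>E UNIV V \<subseteq> U"
        by (intro exI[of _ V]) simp
    qed
    then show "openin ?T {x \<in> topspace ?T. id x \<in> U}" by simp
  qed (simp add: Metric_space.topspace_mtopology[OF Metric_space_bidist])
  ultimately have "compactin bitop (id ` (UNIV :: 'a biseq set))" by (rule image_compactin)
  then show ?thesis by simp
qed

text \<open>Heine-Cantor in window form. Windows are nested: if \<open>x\<close> lies in the window
  around \<open>p\<close> and \<open>y\<close> agrees with \<open>x\<close> at least as far, then
  \<open>y\<close> lies in the same window, so the maximum of the finitely many radii is
  enough.\<close>

lemma uniformly_continuous_potential:
  fixes X :: "('a::finite) biseq set"
  assumes X: "closedin bitop X" and \<phi>: "continuous_map (subtopology bitop X) euclideanreal \<phi>"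
    and e: "0 < e"
  shows "\<exists>k. \<forall>x\<in>X. \<forall>y\<in>X. (\<forall>n. nat \<bar>n\<bar> \<le> k \<longrightarrow> x n = y n) \<longrightarrow> \<bar>\<phi> x - \<phi> y\<bar> < e"
proof -
  define C where "C x k = {y. \<forall>n. nat \<bar>n\<bar> \<le> k \<longrightarrow> x n = y n}" for x :: "'a biseq" and k :: nat
  have open_C: "openin bitop (C x k)" for x k
    unfolding openin_bitop_iff C_def by (intro ballI exI[of _ k]) simp
  have cpt: "compactin bitop X"
    by (rule closed_compactin[OF compactin_bitop _ X]) simp
  have "\<exists>k. \<forall>y\<in>X. y \<in> C x k \<longrightarrow> \<bar>\<phi> y - \<phi> x\<bar> < e / 2" if x: "x \<in> X" for x
  proof -
    have "openin (subtopology bitop X) {y \<in> topspace (subtopology bitop X). \<phi> y \<in> ball (\<phi> x) (e / 2)}"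
      using \<phi> by (rule openin_continuous_map_preimage) simp
    then obtain S where S: "openin bitop S"
      "{y \<in> topspace (subtopology bitop X). \<phi> y \<in> ball (\<phi> x) (e / 2)} = S \<inter> X"
      unfolding openin_subtopology by auto
    have *: "y \<in> S \<longleftrightarrow> \<bar>\<phi> y - \<phi> x\<bar> < e / 2" if "y \<in> X" for y
    proof -
      have "y \<in> topspace (subtopology bitop X)"
        using that by (simp add: Metric_space.topspace_mtopology[OF Metric_space_bidist])
      then have "y \<in> S \<longleftrightarrow> \<phi> y \<in> ball (\<phi> x) (e / 2)" using S(2) that by blast
      then show ?thesis by (simp add: dist_real_def abs_minus_commute)
    qed
    have "x \<in> S" using x e * by simp
    then obtain k where "\<And>y. (\<forall>n. nat \<bar>n\<bar> \<le> k \<longrightarrow> x n = y n) \<Longrightarrow> y \<in> S"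
      using S(1) openin_bitop_iff[of S] by blast
    then have "\<forall>y\<in>X. y \<in> C x k \<longrightarrow> \<bar>\<phi> y - \<phi> x\<bar> < e / 2" using * unfolding C_def by blast
    then show ?thesis ..
  qed
  then obtain k where k: "\<And>x y. x \<in> X \<Longrightarrow> y \<in> X \<Longrightarrow> y \<in> C x (k x) \<Longrightarrow> \<bar>\<phi> y - \<phi> x\<bar> < e / 2"
    by metis
  have "x \<in> C x (k x)" for x by (simp add: C_def)
  then have "X \<subseteq> \<Union>((\<lambda>x. C x (k x)) ` X)" by blast
  then have "\<exists>F. finite F \<and> F \<subseteq> (\<lambda>x. C x (k x)) ` X \<and> X \<subseteq> \<Union>F"
    using cpt open_C by (intro compactinD) blast+
  then obtain G where G: "finite G" "G \<subseteq> (\<lambda>x. C x (k x)) ` X" "X \<subseteq> \<Union>G" by blast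
  then obtain F where F: "finite F" "F \<subseteq> X" "X \<subseteq> (\<Union>x\<in>F. C x (k x))"
    using finite_subset_image[OF G(1,2)] by blast
  \<comment> \<open>Inserting 0 keeps the maximum meaningful when the subcover is empty.\<close>
  define m where "m = Max (insert 0 (k ` F))"
  have m: "k p \<le> m" if "p \<in> F" for p
    unfolding m_def using F(1) that by (intro Max_ge) auto
  have "\<bar>\<phi> x - \<phi> y\<bar> < e" if x: "x \<in> X" and y: "y \<in> X" and xy: "\<forall>n. nat \<bar>n\<bar> \<le> m \<longrightarrow> x n = y n" for x y
  proof -
    obtain p where p: "p \<in> F" "x \<in> C p (k p)" using F(3) x by blast
    then have "y \<in> C p (k p)" using xy m[OF p(1)] by (auto simp: C_def)
    then have "\<bar>\<phi> x - \<phi> p\<bar> < e / 2" "\<bar>\<phi> y - \<phi> p\<bar> < e / 2" using k p F(2) x y by blast+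
    then show ?thesis by linarith
  qed
  then show ?thesis by blast
qed

locale continuous_potential = invariant_set X \<phi>
  for X :: "('a::finite) biseq set" and \<phi> :: "'a biseq \<Rightarrow> real" +
  assumes closed_X: "closedin bitop X"
    and continuous_\<phi>: "continuous_map (subtopology bitop X) euclideanreal \<phi>"
begin

lemma bounded_\<phi>: "\<exists>B. \<forall>x\<in>X. \<bar>\<phi> x\<bar> \<le> B"
proof -
  have "compactin bitop X"
    by (rule closed_compactin[OF compactin_bitop _ closed_X]) simp
  then have "compactin (subtopology bitop X) X" by (simp add: compactin_subtopology)
  then have "compactin euclideanreal (\<phi> ` X)" using continuous_\<phi> by (rule image_compactin)
  then have "bounded (\<phi> ` X)" by (simp add: compact_imp_bounded)
  then show ?thesis by (simp add: bounded_iff)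
qed

text \<open>In the induction, the new summand is evaluated after \<open>n\<close> shifts and sees a
  window displaced by \<open>n\<close>, so its radius grows from \<open>k2\<close> to
  \<open>k2 + n\<close>.\<close>

lemma birkhoff_uniformly_continuous:
  "0 < e \<Longrightarrow> \<exists>k. \<forall>x\<in>X. \<forall>y\<in>X. (\<forall>i. nat \<bar>i\<bar> \<le> k \<longrightarrow> x i = y i) \<longrightarrow>
    \<bar>birkhoff \<phi> n x - birkhoff \<phi> n y\<bar> \<le> e"
proof (induction n arbitrary: e)
  case 0
  then show ?case by (simp add: birkhoff_def)
next
  case (Suc n)
  obtain k1 where k1: "\<And>x y. x \<in> X \<Longrightarrow> y \<in> X \<Longrightarrow> (\<forall>i. nat \<bar>i\<bar> \<le> k1 \<longrightarrow> x i = y i) \<Longrightarrow>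
    \<bar>birkhoff \<phi> n x - birkhoff \<phi> n y\<bar> \<le> e / 2"
    using Suc.IH[of "e / 2"] Suc.prems by auto
  obtain k2 where k2: "\<And>x y. x \<in> X \<Longrightarrow> y \<in> X \<Longrightarrow> (\<forall>i. nat \<bar>i\<bar> \<le> k2 \<longrightarrow> x i = y i) \<Longrightarrow>
    \<bar>\<phi> x - \<phi> y\<bar> < e / 2"
    using uniformly_continuous_potential[OF closed_X continuous_\<phi>, of "e / 2"] Suc.prems by auto
  have "\<bar>birkhoff \<phi> (Suc n) x - birkhoff \<phi> (Suc n) y\<bar> \<le> e"
    if x: "x \<in> X" "y \<in> X" and xy: "\<forall>i. nat \<bar>i\<bar> \<le> max k1 (k2 + n) \<longrightarrow> x i = y i" for x y
  proof -
    have "\<bar>birkhoff \<phi> n x - birkhoff \<phi> n y\<bar> \<le> e / 2" using k1[OF x] xy by simp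
    moreover have "(shift ^^ n) x i = (shift ^^ n) y i" if "nat \<bar>i\<bar> \<le> k2" for i
    proof -
      have "nat \<bar>i + int n\<bar> \<le> max k1 (k2 + n)" using that by linarith
      then show ?thesis using xy by (simp add: shift_funpow)
    qed
    then have "\<bar>\<phi> ((shift ^^ n) x) - \<phi> ((shift ^^ n) y)\<bar> < e / 2"
      using k2 x by simp
    ultimately show ?thesis unfolding birkhoff_def sum.lessThan_Suc by linarith
  qed
  then show ?case by blast
qed

text \<open>A superlevel set is a union of leaf cylinders: within half of the gap
  \<open>g y - a\<close>, values near \<open>y\<close> stay above \<open>a\<close>.\<close>

lemma borel_measurable_leaf:
  fixes g :: "'a biseq \<Rightarrow> real"
  assumes "\<And>e. 0 < e \<Longrightarrow> \<exists>k. \<forall>x\<in>X. \<forall>y\<in>X. (\<forall>i. nat \<bar>i\<bar> \<le> k \<longrightarrow> x i = y i) \<longrightarrow> \<bar>g x - g y\<bar> \<le> e"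
  shows "g \<in> borel_measurable (leaf_measure X \<phi> R p)"
proof (rule borel_measurableI_greater)
  fix a :: real
  let ?W = "Wu X R p"
  have "{x \<in> ?W. a < g x} \<in> sets (leaf_measure X \<phi> R p)"
    unfolding sets_leaf_measure
  proof (rule sigma_sets_cylindersI)
    fix y assume y: "y \<in> {x \<in> ?W. a < g x}"
    then obtain k where k: "\<And>x z. x \<in> X \<Longrightarrow> z \<in> X \<Longrightarrow> (\<forall>i. nat \<bar>i\<bar> \<le> k \<longrightarrow> x i = z i) \<Longrightarrow> \<bar>g x - g z\<bar> \<le> (g y - a) / 2"
      using assms[of "(g y - a) / 2"] by auto
    have yW: "y \<in> Wu_loc X p" using y by (simp add: Wu_def)
    then have yX: "y \<in> X" by (simp add: Wu_loc_def)
    have "?W \<inter> cyl_plus X (prefix (Suc k) y) \<subseteq> {x \<in> ?W. a < g x}"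
    proof
      fix z assume z: "z \<in> ?W \<inter> cyl_plus X (prefix (Suc k) y)"
      have "y n = z n" if "nat \<bar>n\<bar> \<le> k" for n
        using that z yW by (intro cyl_prefix_agree[of z X p k]) (auto simp: Wu_def)
      then have "\<bar>g y - g z\<bar> \<le> (g y - a) / 2"
        using k[of y z] yX z Wu_subset[of X R p] by blast
      moreover have "a < g y" using y by simp
      ultimately have "a < g z" unfolding abs_le_iff by (simp add: field_simps)
      then show "z \<in> {x \<in> ?W. a < g x}" using z by simp
    qed
    moreover have "y \<in> cyl_plus X (prefix (Suc k) y)" using yX by (simp add: in_cyl_prefix_iff)
    ultimately show "\<exists>u. y \<in> cyl_plus X u \<and> ?W \<inter> cyl_plus X u \<subseteq> {x \<in> ?W. a < g x}" by blast
  qed simp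
  then show "{x \<in> space (leaf_measure X \<phi> R p). a < g x} \<in> sets (leaf_measure X \<phi> R p)" by simp
qed

lemma measurable_into_leaf:
  assumes "g \<in> Wu X Q p \<rightarrow> Wu X R q"
    and "\<And>u. {x \<in> Wu X Q p. g x \<in> cyl_plus X u} \<in> sets (leaf_measure X \<phi> Q p)"
  shows "g \<in> measurable (leaf_measure X \<phi> Q p) (leaf_measure X \<phi> R q)"
proof (rule measurable_sigma_sets[OF sets_leaf_measure])
  fix B assume "B \<in> range (\<lambda>u. Wu X R q \<inter> cyl_plus X u)"
  then obtain u where "B = Wu X R q \<inter> cyl_plus X u" by auto
  then have "g -` B \<inter> Wu X Q p = {x \<in> Wu X Q p. g x \<in> cyl_plus X u}" using assms(1) by blast
  then show "g -` B \<inter> space (leaf_measure X \<phi> Q p) \<in> sets (leaf_measure X \<phi> Q p)"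
    using assms(2)[of u] by simp
qed (use assms(1) in auto)

end

section \<open>Holonomies\<close>

definition partial_Delta :: "('a biseq \<Rightarrow> real) \<Rightarrow> nat \<Rightarrow> 'a biseq \<Rightarrow> 'a biseq \<Rightarrow> real" where
  "partial_Delta \<phi> N x' x = (\<Sum>n<N. \<phi> ((shift ^^ n) x') - \<phi> ((shift ^^ n) x))"

lemma partial_Delta_eq: "partial_Delta \<phi> n x' x = birkhoff \<phi> n x' - birkhoff \<phi> n x"
  by (simp add: partial_Delta_def birkhoff_def sum_subtractf)

text \<open>A stable holonomy changes only the past. Coordinate 0 is taken from \<open>z\<close>, so
  the agreement \<open>z 0 = x 0\<close> is what preserves the first letter.\<close>

lemma hol_cyl_iff:
  assumes "z \<in> X" "x \<in> X" "bracket z x \<in> X" "z 0 = x 0"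
  shows "hol y z x \<in> cyl_plus X u \<longleftrightarrow> x \<in> cyl_plus X u"
proof -
  have "bracket z x (int i) = x (int i)" for i using assms(4) by (simp add: bracket_def)
  then show ?thesis using assms by (simp add: cyl_plus_def hol_def)
qed

locale rectangle_family = continuous_potential X \<phi>
  for X :: "('a::finite) biseq set" and \<phi> :: "'a biseq \<Rightarrow> real" +
  fixes \<R> :: "'a biseq set set"
  assumes rectangles: "\<And>R. R \<in> \<R> \<Longrightarrow> rectangle X R"
    and invariant: "lang_invariant X \<R>"
    and sigma_finite_leaf: "\<And>R y. R \<in> \<R> \<Longrightarrow> y \<in> R \<Longrightarrow> sigma_finite_measure (leaf_measure X \<phi> R y)"
begin

section \<open>Holonomies inside one rectangle\<close>

lemma rectangle_subset: "R \<in> \<R> \<Longrightarrow> x \<in> R \<Longrightarrow> x \<in> X"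
  using rectangles unfolding rectangle_def by blast

lemma rectangle_zero: "R \<in> \<R> \<Longrightarrow> x \<in> R \<Longrightarrow> y \<in> R \<Longrightarrow> x 0 = y 0"
  using rectangles unfolding rectangle_def by blast

lemma rectangle_bracket: "R \<in> \<R> \<Longrightarrow> x \<in> R \<Longrightarrow> y \<in> R \<Longrightarrow> bracket x y \<in> R"
  using rectangles unfolding rectangle_def by blast

lemma Wu_subset_rectangle: "x \<in> Wu X R y \<Longrightarrow> x \<in> R"
  by (simp add: Wu_def)

lemma hol_mem:
  assumes "R \<in> \<R>" "z \<in> R" "x \<in> R"
  shows "hol y z x \<in> Wu X R z"
  using rectangle_bracket[OF assms] rectangle_subset[OF assms(1)]
  by (simp add: Wu_def Wu_loc_def hol_def bracket_def)

lemma hol_cyl: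
  assumes "R \<in> \<R>" "z \<in> R" "x \<in> R"
  shows "hol y z x \<in> cyl_plus X u \<longleftrightarrow> x \<in> cyl_plus X u"
  using assms rectangle_bracket[OF assms] rectangle_subset[OF assms(1)] rectangle_zero[OF assms]
  by (intro hol_cyl_iff) auto

lemma hol_hol:
  assumes "x \<in> Wu X R y"
  shows "hol z y (hol y z x) = x"
  using assms by (auto simp: hol_def bracket_def Wu_def Wu_loc_def fun_eq_iff)

text \<open>Writing images as preimages under the inverse holonomy makes them measurable and
  identifies the pushforward measures.\<close>

lemma hol_image:
  assumes R: "R \<in> \<R>" "y \<in> R" "z \<in> R" and Y: "Y \<subseteq> Wu X R y"
  shows "hol y z ` Y = hol z y -` Y \<inter> Wu X R z"
proof (intro equalityI subsetI)
  fix p assume "p \<in> hol y z ` Y"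
  then obtain x where x: "x \<in> Y" "p = hol y z x" by blast
  then have "x \<in> R" using Y Wu_subset_rectangle by blast
  then have "p \<in> Wu X R z" using hol_mem[OF R(1,3)] x(2) by simp
  moreover have "hol z y p \<in> Y" using hol_hol[of x R y z] Y x by auto
  ultimately show "p \<in> hol z y -` Y \<inter> Wu X R z" by simp
next
  fix p assume p: "p \<in> hol z y -` Y \<inter> Wu X R z"
  then have "p = hol y z (hol z y p)" using hol_hol[of p R z y] by simp
  then show "p \<in> hol y z ` Y" using p by blast
qed

lemma hol_image_cyl:
  assumes R: "R \<in> \<R>" "y \<in> R" "z \<in> R"
  shows "hol y z ` (Wu X R y \<inter> cyl_plus X u) = Wu X R z \<inter> cyl_plus X u"
proof -
  have "hol z y p \<in> Wu X R y \<inter> cyl_plus X u \<longleftrightarrow> p \<in> cyl_plus X u" if "p \<in> Wu X R z" for p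
    using hol_mem[OF R(1,2), of p z] hol_cyl[OF R(1,2), of p z u] Wu_subset_rectangle[OF that] by simp
  then show ?thesis using hol_image[OF R, of "Wu X R y \<inter> cyl_plus X u"] by blast
qed

lemma hol_measurable:
  assumes R: "R \<in> \<R>" "y \<in> R" "z \<in> R"
  shows "hol y z \<in> measurable (leaf_measure X \<phi> R y) (leaf_measure X \<phi> R z)"
proof (rule measurable_into_leaf)
  show "hol y z \<in> Wu X R y \<rightarrow> Wu X R z"
    using hol_mem[OF R(1,3)] Wu_subset_rectangle by blast
  have "{x \<in> Wu X R y. hol y z x \<in> cyl_plus X u} = Wu X R y \<inter> cyl_plus X u" for u
    using hol_cyl[OF R(1,3)] Wu_subset_rectangle by blast
  then show "{x \<in> Wu X R y. hol y z x \<in> cyl_plus X u} \<in> sets (leaf_measure X \<phi> R y)" for u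
    by simp
qed

lemma sets_leaf_subset: "Y \<in> sets (leaf_measure X \<phi> R y) \<Longrightarrow> Y \<subseteq> Wu X R y"
  using sets.sets_into_space by fastforce

lemma hol_image_sets:
  assumes R: "R \<in> \<R>" "y \<in> R" "z \<in> R" and Y: "Y \<in> sets (leaf_measure X \<phi> R y)"
  shows "hol y z ` Y \<in> sets (leaf_measure X \<phi> R z)"
  using measurable_sets[OF hol_measurable[OF R(1,3,2)] Y] hol_image[OF R sets_leaf_subset[OF Y]] by simp

lemma emeasure_distr_hol:
  assumes R: "R \<in> \<R>" "y \<in> R" "z \<in> R" and Y: "Y \<in> sets (leaf_measure X \<phi> R y)"
  shows "emeasure (distr (leaf_measure X \<phi> R z) (leaf_measure X \<phi> R y) (hol z y)) Y = mu X \<phi> z (hol y z ` Y)"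
  using emeasure_distr[OF hol_measurable[OF R(1,3,2)] Y] hol_image[OF R sets_leaf_subset[OF Y]]
    emeasure_leaf_measure[OF hol_image_sets[OF R Y]] by simp

lemma hol_Ws:
  assumes R: "R \<in> \<R>" "y \<in> R" "z \<in> R" and x: "x \<in> Wu X R y"
  shows "hol y z x \<in> Ws X R x"
  using rectangle_bracket[OF R(1,3) Wu_subset_rectangle[OF x]] rectangle_subset[OF R(1)]
    rectangle_zero[OF R(1,3) Wu_subset_rectangle[OF x]]
  by (auto simp: Ws_def Ws_loc_def hol_def bracket_def)

text \<open>Every stable pair is a point together with its holonomy image, so estimates for
  holonomies apply to all of \<open>stable_pairs\<close>.\<close>

lemma hol_of_Ws: "x' \<in> Ws X R x \<Longrightarrow> hol x x' x = x'"
  by (auto simp: Ws_def Ws_loc_def hol_def bracket_def fun_eq_iff)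

text \<open>Only one of the two inequalities is kept, at fixed constants; exchanging the leaves
  restores the other.\<close>

definition hol_bound :: "real \<Rightarrow> real \<Rightarrow> bool" where
  "hol_bound e \<delta> \<longleftrightarrow> (\<forall>R\<in>\<R>. \<forall>y\<in>R. \<forall>z\<in>R. bidist y z < \<delta> \<longrightarrow>
     (\<forall>Y\<in>sets (leaf_measure X \<phi> R y). mu X \<phi> z (hol y z ` Y) \<le> ennreal (exp e) * mu X \<phi> y Y))"

lemma hol_boundD:
  assumes "hol_bound e \<delta>" "R \<in> \<R>" "y \<in> R" "z \<in> R" "bidist y z < \<delta>" "Y \<in> sets (leaf_measure X \<phi> R y)"
  shows "mu X \<phi> z (hol y z ` Y) \<le> ennreal (exp e) * mu X \<phi> y Y"
  using assms unfolding hol_bound_def by blast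

text \<open>The upper bound for \<open>mu X \<phi> y Y\<close> is the one-sided bound for the
  inverse holonomy applied to the image of \<open>Y\<close>, since the distance is
  symmetric.\<close>

lemma unif_cont_holonomies_iff:
  "unif_cont_holonomies X \<phi> \<R> \<longleftrightarrow> (\<forall>e>0. \<exists>\<delta>>0. hol_bound e \<delta>)"
proof
  assume "unif_cont_holonomies X \<phi> \<R>"
  then show "\<forall>e>0. \<exists>\<delta>>0. hol_bound e \<delta>"
    unfolding unif_cont_holonomies_def hol_bound_def ennreal_exp_mult_le_iff by meson
next
  assume r: "\<forall>e>0. \<exists>\<delta>>0. hol_bound e \<delta>"
  show "unif_cont_holonomies X \<phi> \<R>"
    unfolding unif_cont_holonomies_def
  proof (intro allI impI)
    fix e :: real assume "0 < e"
    then obtain \<delta> where \<delta>: "0 < \<delta>" "hol_bound e \<delta>" using r by blast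
    have "ennreal (exp (- e)) * mu X \<phi> z (hol y z ` Y) \<le> mu X \<phi> y Y \<and>
        mu X \<phi> y Y \<le> ennreal (exp e) * mu X \<phi> z (hol y z ` Y)"
      if R: "R \<in> \<R>" "y \<in> R" "z \<in> R" and d: "bidist y z < \<delta>" and Y: "Y \<in> sets (leaf_measure X \<phi> R y)"
      for R y z Y
    proof
      show "ennreal (exp (- e)) * mu X \<phi> z (hol y z ` Y) \<le> mu X \<phi> y Y"
        using hol_boundD[OF \<delta>(2) R d Y] by (simp only: ennreal_exp_mult_le_iff)
      have "bidist z y < \<delta>"
        using d by (simp add: Metric_space.commute[OF Metric_space_bidist])
      then have "mu X \<phi> y (hol z y ` hol y z ` Y) \<le> ennreal (exp e) * mu X \<phi> z (hol y z ` Y)"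
        by (intro hol_boundD[OF \<delta>(2) R(1,3,2)] hol_image_sets[OF R Y])
      moreover have "hol z y ` hol y z ` Y = Y"
        unfolding image_image using hol_hol[of _ R y z] sets_leaf_subset[OF Y]
        by (simp add: subset_iff cong: image_cong)
      ultimately show "mu X \<phi> y Y \<le> ennreal (exp e) * mu X \<phi> z (hol y z ` Y)" by simp
    qed
    then show "\<exists>\<delta>>0. \<forall>R\<in>\<R>. \<forall>y\<in>R. \<forall>z\<in>R. bidist y z < \<delta> \<longrightarrow>
        (\<forall>Y\<in>sets (leaf_measure X \<phi> R y).
           ennreal (exp (- e)) * mu X \<phi> z (hol y z ` Y) \<le> mu X \<phi> y Y \<and>
           mu X \<phi> y Y \<le> ennreal (exp e) * mu X \<phi> z (hol y z ` Y))"
      using \<delta>(1) by blast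
  qed
qed

section \<open>Shifting a rectangle along a word\<close>

lemma shifted_rectangle:
  assumes R: "R \<in> \<R>" and u: "length u = Suc n" "R \<inter> cyl_plus X u \<noteq> {}"
  shows "(shift ^^ n) ` (R \<inter> cyl_plus X u) \<in> \<R>"
proof -
  have "u \<in> lang X (n + 1)" using u by (auto simp: lang_def)
  then show ?thesis using invariant R u(2) unfolding lang_invariant_def by blast
qed

text \<open>Lying on one leaf after the shift means agreeing up to coordinate \<open>n\<close>
  before it, and on \<open>cyl_plus X u\<close> the coordinates 0 to \<open>n\<close> already agree.
  Equality of the sets matters because the leaf is the space of the measure.\<close>

lemma shifted_leaf:
  assumes u: "length u = Suc n" and x: "x \<in> Wu X R y \<inter> cyl_plus X u"
  shows "Wu X ((shift ^^ n) ` (R \<inter> cyl_plus X u)) ((shift ^^ n) x) = (shift ^^ n) ` (Wu X R y \<inter> cyl_plus X u)"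
proof (intro equalityI subsetI)
  fix p assume p: "p \<in> Wu X ((shift ^^ n) ` (R \<inter> cyl_plus X u)) ((shift ^^ n) x)"
  then obtain q where q: "q \<in> R" "q \<in> cyl_plus X u" "p = (shift ^^ n) q" by (auto simp: Wu_def)
  have "q k = y k" if "k \<le> 0" for k
  proof -
    have "p (k - int n) = (shift ^^ n) x (k - int n)" using p that by (simp add: Wu_def Wu_loc_def)
    then have "q k = x k" by (simp add: q(3) shift_funpow)
    also have "x k = y k" using x that by (simp add: Wu_def Wu_loc_def)
    finally show ?thesis .
  qed
  then have "q \<in> Wu X R y" using q(1,2) cyl_plus_subset[of X u] by (auto simp: Wu_def Wu_loc_def)
  then show "p \<in> (shift ^^ n) ` (Wu X R y \<inter> cyl_plus X u)" using q by blast
next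
  fix p assume "p \<in> (shift ^^ n) ` (Wu X R y \<inter> cyl_plus X u)"
  then obtain q where q: "q \<in> Wu X R y" "q \<in> cyl_plus X u" "p = (shift ^^ n) q" by blast
  have "(shift ^^ n) q \<in> Wu_loc X ((shift ^^ n) x)"
  proof (rule shift_Wu_loc)
    show "n < length u" using u by simp
    show "x \<in> Wu_loc X y \<inter> cyl_plus X u" "q \<in> Wu_loc X y" using x q by (auto simp: Wu_def)
    show "q (int i) = u ! i" if "i \<le> n" for i using that q(2) u by (simp add: cyl_plus_def)
  qed
  then show "p \<in> Wu X ((shift ^^ n) ` (R \<inter> cyl_plus X u)) ((shift ^^ n) x)"
    using q by (auto simp: Wu_def)
qed

text \<open>On the shifted leaf the first \<open>n\<close> letters of the pulled-back point are
  those of \<open>u\<close>, so a cylinder condition \<open>v\<close> is either contradictory or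
  reduces to the letters of \<open>v\<close> after position \<open>n\<close>.\<close>

lemma unshift_measurable:
  assumes u: "length u = Suc n" and x: "x \<in> Wu X R y \<inter> cyl_plus X u"
  shows "unshift n \<in> measurable
    (leaf_measure X \<phi> ((shift ^^ n) ` (R \<inter> cyl_plus X u)) ((shift ^^ n) x)) (leaf_measure X \<phi> R y)"
    (is "_ \<in> measurable (leaf_measure X \<phi> ?R ?x) _")
proof (rule measurable_into_leaf)
  show "unshift n \<in> Wu X ?R ?x \<rightarrow> Wu X R y" unfolding shifted_leaf[OF u x] by auto
  fix v
  have W: "p \<in> X \<and> (\<forall>i\<le>n. unshift n p (int i) = u ! i)" if p: "p \<in> Wu X ?R ?x" for p
  proof -
    obtain q where "q \<in> cyl_plus X u" "p = (shift ^^ n) q"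
      using p unfolding shifted_leaf[OF u x] by blast
    then show ?thesis using u by (simp add: cyl_plus_def)
  qed
  show "{p \<in> Wu X ?R ?x. unshift n p \<in> cyl_plus X v} \<in> sets (leaf_measure X \<phi> ?R ?x)"
  proof (cases "\<forall>i<min n (length v). u ! i = v ! i")
    case True
    have "unshift n p \<in> cyl_plus X v \<longleftrightarrow> p \<in> cyl_plus X (drop n v)" if p: "p \<in> Wu X ?R ?x" for p
    proof (cases "n \<le> length v")
      case n: True
      then show ?thesis using True W[OF p] cyl_plus_split[OF n, of "unshift n p"] by simp
    next
      case False
      \<comment> \<open>If \<open>v\<close> is shorter than \<open>n\<close>, then
        \<open>drop n v\<close> is the empty word, whose cylinder is all of
        \<open>X\<close>.\<close>
      then show ?thesis using True W[OF p] by (simp add: cyl_plus_def)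
    qed
    then have "{p \<in> Wu X ?R ?x. unshift n p \<in> cyl_plus X v} = Wu X ?R ?x \<inter> cyl_plus X (drop n v)" by blast
    then show ?thesis by simp
  next
    case False
    then obtain i where i: "i < n" "i < length v" "u ! i \<noteq> v ! i" by auto
    have "unshift n p \<notin> cyl_plus X v" if "p \<in> Wu X ?R ?x" for p
      using W[OF that] i by (auto simp: cyl_plus_def)
    then have "{p \<in> Wu X ?R ?x. unshift n p \<in> cyl_plus X v} = {}" by blast
    then show ?thesis by (simp only: sets.empty_sets)
  qed
qed

lemma shift_image_sets:
  assumes u: "length u = Suc n" and x: "x \<in> Wu X R y \<inter> cyl_plus X u"
    and Y: "Y \<in> sets (leaf_measure X \<phi> R y)" "Y \<subseteq> cyl_plus X u"
  shows "(shift ^^ n) ` Y \<in> sets (leaf_measure X \<phi> ((shift ^^ n) ` (R \<inter> cyl_plus X u)) ((shift ^^ n) x))"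
    (is "_ \<in> sets (leaf_measure X \<phi> ?R ?x)")
proof -
  have "(shift ^^ n) ` Y = unshift n -` Y \<inter> Wu X ?R ?x"
    unfolding shifted_leaf[OF u x] using Y(2) sets_leaf_subset[OF Y(1)] by force
  then show ?thesis using measurable_sets[OF unshift_measurable[OF u x] Y(1)] by simp
qed

section \<open>Comparison of two leaves of a rectangle\<close>

definition window :: "nat \<Rightarrow> real \<Rightarrow> nat \<Rightarrow> bool" where
  "window n \<eta> k \<longleftrightarrow> (\<forall>a\<in>X. \<forall>b\<in>X. (\<forall>i. nat \<bar>i\<bar> \<le> k \<longrightarrow> a i = b i) \<longrightarrow>
     \<bar>birkhoff \<phi> n a - birkhoff \<phi> n b\<bar> \<le> \<eta>)"

lemma window_exists: "0 < \<eta> \<Longrightarrow> \<exists>k. window n \<eta> k"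
  unfolding window_def by (rule birkhoff_uniformly_continuous)

text \<open>The leaf supplies the nonpositive coordinates and the word \<open>u\<close> the positive
  ones up to \<open>k\<close>, so together they fill the symmetric window.\<close>

lemma window_leaf:
  assumes "window n \<eta> k" "k < length u" "a \<in> Wu_loc X y \<inter> cyl_plus X u" "b \<in> Wu_loc X y \<inter> cyl_plus X u"
  shows "\<bar>birkhoff \<phi> n a - birkhoff \<phi> n b\<bar> \<le> \<eta>"
proof -
  have "a i = b i" if "nat \<bar>i\<bar> \<le> k" for i
  proof (cases "i \<le> 0")
    case False
    then have "nat i < length u" "i = int (nat i)" using that assms(2) by auto
    then show ?thesis using assms(3,4) by (metis (mono_tags, lifting) IntD2 cyl_plus_def mem_Collect_eq)
  qed (use assms(3,4) in \<open>simp add: Wu_loc_def\<close>)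
  then show ?thesis using assms unfolding window_def by (auto simp: Wu_loc_def)
qed

text \<open>Pushing forward by \<open>shift ^^ n\<close> brings the two leaves within \<open>\<delta>\<close> of each other.\<close>

lemma hol_le:
  assumes R: "R \<in> \<R>" "y \<in> R" "z \<in> R" and hb: "hol_bound e \<delta>" and n: "(1/2) ^ n < \<delta>"
    and u: "n < length u" "k < length u" "window n \<eta> k"
    and x: "x \<in> Wu X R y \<inter> cyl_plus X u"
    and Y: "Y \<in> sets (leaf_measure X \<phi> R y)" "Y \<subseteq> cyl_plus X u"
  shows "mu X \<phi> z (hol y z ` Y)
    \<le> ennreal (exp (partial_Delta \<phi> n (hol y z x) x + e + 2 * \<eta>)) * mu X \<phi> y Y"
proof -
  define x' where "x' = hol y z x"
  \<comment> \<open>Invariance of the family under \<open>n\<close> shifts concerns words of length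
    exactly \<open>n + 1\<close>; the longer \<open>u\<close> serves to control the Birkhoff
    sums.\<close>
  define w where "w = take (Suc n) u"
  have w: "length w = Suc n" using u(1) by (simp add: w_def)
  have sub: "cyl_plus X u \<subseteq> cyl_plus X w" by (auto simp: cyl_plus_def w_def)
  have xR: "x \<in> R" using x Wu_subset_rectangle by blast
  have x': "x' \<in> Wu X R z \<inter> cyl_plus X u"
    using hol_mem[OF R(1,3) xR] hol_cyl[OF R(1,3) xR] x by (simp add: x'_def)
  have Yu: "Y \<subseteq> Wu X R y \<inter> cyl_plus X u" using Y sets_leaf_subset by blast
  have Zu: "hol y z ` Y \<subseteq> Wu X R z \<inter> cyl_plus X u"
    using Yu hol_image_cyl[OF R, of u] by blast
  define Q where "Q = (shift ^^ n) ` (R \<inter> cyl_plus X w)"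
  have mem: "(shift ^^ n) x \<in> Q" "(shift ^^ n) x' \<in> Q"
    unfolding Q_def using x x' sub Wu_subset_rectangle by blast+
  have Q: "Q \<in> \<R>"
    unfolding Q_def using shifted_rectangle[OF R(1) w] xR x sub by blast
  have "(shift ^^ n) x i = (shift ^^ n) x' i" if "nat \<bar>i\<bar> < n" for i
  proof -
    have "0 < i + int n" using that by linarith
    then show ?thesis by (simp add: shift_funpow x'_def hol_def bracket_def)
  qed
  then have "bidist ((shift ^^ n) x) ((shift ^^ n) x') \<le> (1/2) ^ n" by (rule bidist_le)
  then have dist: "bidist ((shift ^^ n) x) ((shift ^^ n) x') < \<delta>" using n by linarith
  \<comment> \<open>The two sides could differ only at the old coordinates from 1 to
    \<open>n\<close>, which one side takes from \<open>x\<close> and the other from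
    \<open>v\<close>. Both points follow \<open>u\<close> there.\<close>
  have "hol ((shift ^^ n) x) ((shift ^^ n) x') ((shift ^^ n) v) = (shift ^^ n) (hol y z v)" if v: "v \<in> Y" for v
  proof
    fix k :: int
    have "v k = x k" if "0 < k" "k \<le> int n" for k
    proof -
      have "nat k < length u" "k = int (nat k)" using that u(1) by auto
      moreover have "v (int i) = x (int i)" if "i < length u" for i
        using that v Yu x by (auto simp: cyl_plus_def subset_iff)
      ultimately show ?thesis by metis
    qed
    then show "hol ((shift ^^ n) x) ((shift ^^ n) x') ((shift ^^ n) v) k = (shift ^^ n) (hol y z v) k"
      by (simp add: hol_def bracket_def shift_funpow x'_def)
  qed
  then have img: "hol ((shift ^^ n) x) ((shift ^^ n) x') ` (shift ^^ n) ` Y = (shift ^^ n) ` hol y z ` Y"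
    unfolding image_image by (intro image_cong) auto
  have Ys: "(shift ^^ n) ` Y \<in> sets (leaf_measure X \<phi> Q ((shift ^^ n) x))"
    unfolding Q_def using x sub Y by (intro shift_image_sets[OF w]) auto
  let ?P = "real n * pressure X \<phi>" and ?S = "birkhoff \<phi> n"
  have "mu X \<phi> z (hol y z ` Y)
      \<le> ennreal (exp (?S x' + \<eta> - ?P)) * mu X \<phi> ((shift ^^ n) x') ((shift ^^ n) ` hol y z ` Y)"
  proof (rule mu_le_shift[OF u(1)])
    show "x' \<in> Wu_loc X z \<inter> cyl_plus X u" using x' by (simp add: Wu_def)
    show "hol y z ` Y \<subseteq> Wu_loc X z \<inter> cyl_plus X u" using Zu by (auto simp: Wu_def)
    show "?S a \<le> ?S x' + \<eta>" if "a \<in> Wu_loc X z \<inter> cyl_plus X u" for a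
      using window_leaf[OF u(3,2) that, of x'] x' by (auto simp: Wu_def abs_le_iff)
  qed
  also have "mu X \<phi> ((shift ^^ n) x') ((shift ^^ n) ` hol y z ` Y)
      \<le> ennreal (exp e) * mu X \<phi> ((shift ^^ n) x) ((shift ^^ n) ` Y)"
    using hol_boundD[OF hb Q mem dist Ys] by (simp only: img)
  also have "mu X \<phi> ((shift ^^ n) x) ((shift ^^ n) ` Y) \<le> ennreal (exp (?P - (?S x - \<eta>))) * mu X \<phi> y Y"
  proof (rule mu_shift_le[OF u(1)])
    show "x \<in> Wu_loc X y \<inter> cyl_plus X u" using x by (simp add: Wu_def)
    show "Y \<subseteq> Wu_loc X y \<inter> cyl_plus X u" using Yu by (auto simp: Wu_def)
    show "?S x - \<eta> \<le> ?S a" if "a \<in> Wu_loc X y \<inter> cyl_plus X u" for a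
      using window_leaf[OF u(3,2) that, of x] x by (auto simp: Wu_def abs_le_iff)
  qed
  \<comment> \<open>The three factors come from shifting the image leaf, crossing to the other leaf,
    and shifting back. The pressure terms cancel and the two oscillations add.\<close>
  finally have "mu X \<phi> z (hol y z ` Y) \<le> ennreal (exp (?S x' + \<eta> - ?P)) *
      (ennreal (exp e) * (ennreal (exp (?P - (?S x - \<eta>))) * mu X \<phi> y Y))"
    by (simp add: mult_left_mono)
  also have "\<dots> = ennreal (exp (partial_Delta \<phi> n x' x + e + 2 * \<eta>)) * mu X \<phi> y Y"
    unfolding ennreal_exp_mult partial_Delta_eq by (simp add: algebra_simps)
  finally show ?thesis by (simp add: x'_def)
qed

text \<open>This is \<open>hol_le\<close> for the inverse holonomy at the image point;
  \<open>partial_Delta\<close> changes sign when its arguments are exchanged.\<close>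

lemma hol_ge:
  assumes R: "R \<in> \<R>" "y \<in> R" "z \<in> R" and hb: "hol_bound e \<delta>" and n: "(1/2) ^ n < \<delta>"
    and u: "n < length u" "k < length u" "window n \<eta> k"
    and x: "x \<in> Wu X R y \<inter> cyl_plus X u"
    and Y: "Y \<in> sets (leaf_measure X \<phi> R y)" "Y \<subseteq> cyl_plus X u"
  shows "mu X \<phi> y Y
    \<le> ennreal (exp (- partial_Delta \<phi> n (hol y z x) x + e + 2 * \<eta>)) * mu X \<phi> z (hol y z ` Y)"
proof -
  have xR: "x \<in> R" using x Wu_subset_rectangle by blast
  have YW: "Y \<subseteq> Wu X R y" using Y sets_leaf_subset by blast
  have "hol z y ` hol y z ` Y = Y"
    unfolding image_image using hol_hol[of _ R y z] YW by (simp add: subset_iff cong: image_cong)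
  moreover have "hol y z ` Y \<subseteq> cyl_plus X u" using hol_image_cyl[OF R, of u] Y(2) YW by blast
  moreover have "hol y z x \<in> Wu X R z \<inter> cyl_plus X u"
    using hol_mem[OF R(1,3) xR] hol_cyl[OF R(1,3) xR] x by simp
  ultimately have "mu X \<phi> y Y
    \<le> ennreal (exp (partial_Delta \<phi> n (hol z y (hol y z x)) (hol y z x) + e + 2 * \<eta>)) * mu X \<phi> z (hol y z ` Y)"
    using hol_le[OF R(1,3,2) hb n u, of "hol y z x" "hol y z ` Y"] hol_image_sets[OF R Y(1)] by simp
  moreover have "hol z y (hol y z x) = x" using hol_hol[of x R y z] x by blast
  ultimately show ?thesis by (simp add: partial_Delta_eq)
qed

text \<open>Positivity gives only one leaf of each rectangle. Applied to the shifted piece that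
  follows a long word \<open>v\<close>, it gives some \<open>q\<close> with positive measure on that
  cylinder; conformality carries this back to the leaf of \<open>q\<close>, and the holonomy
  estimate carries it over to the leaf of \<open>x\<close>.\<close>

lemma mu_cylinder_pos:
  assumes pos: "positive_on X \<phi> \<R>" and hb: "hol_bound e \<delta>" "0 < \<delta>"
    and R: "R \<in> \<R>" "x \<in> R" and u: "x \<in> cyl_plus X u"
  shows "0 < mu X \<phi> x (Wu X R x \<inter> cyl_plus X u)"
proof -
  obtain n where n: "(1/2 :: real) ^ n < \<delta>" using real_arch_pow_inv[OF hb(2), of "1/2"] by auto
  obtain k where k: "window n 1 k" using window_exists[of 1 n] by auto
  \<comment> \<open>The word must be long enough for the shift by \<open>n\<close>, for the window
    \<open>k\<close>, and to refine \<open>u\<close>.\<close>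
  define m where "m = Max {n, k, length u}"
  have m: "n \<le> m" "k \<le> m" "length u \<le> m" by (simp_all add: m_def)
  define v where "v = prefix (Suc m) x"
  have v: "length v = Suc m" by (simp add: v_def)
  have xX: "x \<in> X" using R by (rule rectangle_subset)
  then have xv: "x \<in> cyl_plus X v" by (simp add: v_def in_cyl_prefix_iff)
  have sub: "cyl_plus X v \<subseteq> cyl_plus X u"
    using v m xv u by (intro cyl_plus_nested) auto
  have "(shift ^^ m) ` (R \<inter> cyl_plus X v) \<in> \<R>"
    using shifted_rectangle[OF R(1) v] R(2) xv by blast
  then obtain p where "p \<in> (shift ^^ m) ` (R \<inter> cyl_plus X v)"
    "0 < mu X \<phi> p (Wu X ((shift ^^ m) ` (R \<inter> cyl_plus X v)) p)"
    using pos unfolding positive_on_def by blast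
  then obtain q where q: "q \<in> R" "q \<in> cyl_plus X v"
    "0 < mu X \<phi> ((shift ^^ m) q) (Wu X ((shift ^^ m) ` (R \<inter> cyl_plus X v)) ((shift ^^ m) q))"
    by blast
  have qW: "q \<in> Wu X R q" using q(1) rectangle_subset[OF R(1)] by (simp add: Wu_def Wu_loc_def)
  have xW: "x \<in> Wu X R x" using R(2) xX by (simp add: Wu_def Wu_loc_def)
  \<comment> \<open>A crude bound suffices, since only the finiteness of the resulting factor
    matters for positivity.\<close>
  obtain B where B: "\<And>y. y \<in> X \<Longrightarrow> \<bar>\<phi> y\<bar> \<le> B" using bounded_\<phi> by blast
  let ?Z = "Wu X R q \<inter> cyl_plus X v"
  have "mu X \<phi> ((shift ^^ m) q) ((shift ^^ m) ` ?Z)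
      \<le> ennreal (exp (real m * pressure X \<phi> - (\<Sum>i<m. - B))) * mu X \<phi> q ?Z"
  proof (rule mu_shift_le)
    show "m < length v" using v by simp
    show "q \<in> Wu_loc X q \<inter> cyl_plus X v" "?Z \<subseteq> Wu_loc X q \<inter> cyl_plus X v"
      using qW q(2) by (auto simp: Wu_def)
    show "(\<Sum>i<m. - B) \<le> birkhoff \<phi> m a" if "a \<in> Wu_loc X q \<inter> cyl_plus X v" for a
    proof -
      have "a \<in> X" using that by (simp add: Wu_loc_def)
      then show ?thesis unfolding birkhoff_def using B by (intro sum_mono) (auto simp: abs_le_iff minus_le_iff)
    qed
  qed
  then have "0 < mu X \<phi> q ?Z"
    using q(3) shifted_leaf[OF v, of q R q] qW q(2) by (auto simp: zero_less_iff_neq_zero)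
  moreover have "mu X \<phi> q (hol x q ` (Wu X R x \<inter> cyl_plus X v))
      \<le> ennreal (exp (partial_Delta \<phi> n (hol x q x) x + e + 2 * 1)) * mu X \<phi> x (Wu X R x \<inter> cyl_plus X v)"
    using v m xW xv by (intro hol_le[OF R q(1) hb(1) n _ _ k]) auto
  ultimately have "0 < mu X \<phi> x (Wu X R x \<inter> cyl_plus X v)"
    unfolding hol_image_cyl[OF R q(1)] by (auto simp: zero_less_iff_neq_zero)
  also have "\<dots> \<le> mu X \<phi> x (Wu X R x \<inter> cyl_plus X u)"
    using sub by (intro mu_mono) auto
  finally show ?thesis .
qed

text \<open>Countably many sets of finite measure exhaust the leaf, and by subadditivity one of
  their intersections with \<open>A\<close> is not null.\<close>

lemma finite_pos_subset:
  assumes R: "R \<in> \<R>" "y \<in> R" and A: "A \<in> sets (leaf_measure X \<phi> R y)" "0 < mu X \<phi> y A"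
  obtains Y where "Y \<in> sets (leaf_measure X \<phi> R y)" "Y \<subseteq> A" "0 < mu X \<phi> y Y" "mu X \<phi> y Y < \<infinity>"
proof -
  let ?M = "leaf_measure X \<phi> R y"
  interpret sigma_finite_measure ?M using R by (rule sigma_finite_leaf)
  obtain F :: "nat \<Rightarrow> _" where F: "range F \<subseteq> sets ?M" "(\<Union>i. F i) = space ?M" "\<And>i. emeasure ?M (F i) \<noteq> \<infinity>"
    using sigma_finite by blast
  have Fi: "F i \<in> sets ?M" for i using F(1) by blast
  have "(\<Union>i. A \<inter> F i) = A" using F(2) sets_leaf_subset[OF A(1)] by auto
  then have le: "mu X \<phi> y A \<le> (\<Sum>i. mu X \<phi> y (A \<inter> F i))"
    using mu_countably_subadditive[of X \<phi> y "\<lambda>i. A \<inter> F i"] by (simp only:)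
  have "\<exists>i. mu X \<phi> y (A \<inter> F i) \<noteq> 0"
  proof (rule ccontr)
    assume "\<nexists>i. mu X \<phi> y (A \<inter> F i) \<noteq> 0"
    then show False using le A(2) by simp
  qed
  then obtain i where i: "mu X \<phi> y (A \<inter> F i) \<noteq> 0" ..
  have "mu X \<phi> y (A \<inter> F i) \<le> mu X \<phi> y (F i)" by (intro mu_mono) auto
  also have "mu X \<phi> y (F i) < \<infinity>"
    using F(3)[of i] emeasure_leaf_measure[OF Fi] by (simp add: less_top)
  finally show ?thesis
    using that[of "A \<inter> F i"] A(1) Fi i by (simp add: zero_less_iff_neq_zero)
qed

text \<open>One set \<open>Y\<close> of positive finite measure is sent across by the estimate for
  \<open>m\<close> and brought back by the one for \<open>n\<close>. Cancelling its measure leaves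
  an inequality between exponents.\<close>

lemma partial_Delta_Cauchy:
  assumes pos: "positive_on X \<phi> \<R>" and hb: "hol_bound e \<delta>" "0 < \<delta>"
    and R: "R \<in> \<R>" "x \<in> R" "x' \<in> Ws X R x" and n: "(1/2) ^ n < \<delta>" and m: "(1/2) ^ m < \<delta>"
  shows "partial_Delta \<phi> n x' x - partial_Delta \<phi> m x' x \<le> 2 * e"
proof (rule field_le_epsilon)
  fix \<eta> :: real assume "0 < \<eta>"
  \<comment> \<open>Each of the two estimates contributes two oscillations, so a quarter of \<eta>
    for each makes \<eta> in total.\<close>
  then have \<eta>: "0 < \<eta> / 4" by simp
  obtain k l where kl: "window n (\<eta> / 4) k" "window m (\<eta> / 4) l"
    using window_exists[OF \<eta>] by metis
  define u where "u = prefix (Suc (Max {n, m, k, l})) x"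
  have u: "n < length u" "m < length u" "k < length u" "l < length u"
    by (simp_all add: u_def less_Suc_eq_le)
  have xX: "x \<in> X" using R(1,2) by (rule rectangle_subset)
  then have xu: "x \<in> Wu X R x \<inter> cyl_plus X u"
    using R(2) by (simp add: u_def in_cyl_prefix_iff Wu_def Wu_loc_def)
  have x'R: "x' \<in> R" using R(3) by (simp add: Ws_def)
  have "0 < mu X \<phi> x (Wu X R x \<inter> cyl_plus X u)"
    using xu by (intro mu_cylinder_pos[OF pos hb R(1,2)]) auto
  then obtain Y where Y: "Y \<in> sets (leaf_measure X \<phi> R x)" "Y \<subseteq> Wu X R x \<inter> cyl_plus X u"
    "0 < mu X \<phi> x Y" "mu X \<phi> x Y < \<infinity>"
    using finite_pos_subset[OF R(1,2) cyl_in_sets_leaf] by blast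
  have Yu: "Y \<subseteq> cyl_plus X u" using Y(2) by blast
  let ?D = "\<lambda>n. partial_Delta \<phi> n x' x"
  have "mu X \<phi> x Y \<le> ennreal (exp (- ?D n + e + 2 * (\<eta> / 4))) * mu X \<phi> x' (hol x x' ` Y)"
    using hol_ge[OF R(1,2) x'R hb(1) n u(1,3) kl(1) xu Y(1) Yu] by (simp only: hol_of_Ws[OF R(3)])
  also have "mu X \<phi> x' (hol x x' ` Y) \<le> ennreal (exp (?D m + e + 2 * (\<eta> / 4))) * mu X \<phi> x Y"
    using hol_le[OF R(1,2) x'R hb(1) m u(2,4) kl(2) xu Y(1) Yu] by (simp only: hol_of_Ws[OF R(3)])
  finally have "mu X \<phi> x Y \<le> ennreal (exp (- ?D n + e + 2 * (\<eta> / 4))) *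
      (ennreal (exp (?D m + e + 2 * (\<eta> / 4))) * mu X \<phi> x Y)"
    by (simp add: mult_left_mono)
  also have "\<dots> = ennreal (exp (?D m - ?D n + 2 * e + \<eta>)) * mu X \<phi> x Y"
    unfolding ennreal_exp_mult by (simp add: algebra_simps)
  finally have "mu X \<phi> x Y \<le> ennreal (exp (?D m - ?D n + 2 * e + \<eta>)) * mu X \<phi> x Y" .
  moreover obtain r where "mu X \<phi> x Y = ennreal r" "0 < r"
    using Y(3,4) by (cases "mu X \<phi> x Y") auto
  ultimately have "r \<le> exp (?D m - ?D n + 2 * e + \<eta>) * r"
    by (simp add: ennreal_mult[symmetric])
  then have "0 \<le> ?D m - ?D n + 2 * e + \<eta>" using \<open>0 < r\<close> by simp
  then show "?D n - ?D m \<le> 2 * e + \<eta>" by simp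
qed

lemma partial_Delta_uniformly_convergent:
  assumes pos: "positive_on X \<phi> \<R>" and hb: "\<And>e. 0 < e \<Longrightarrow> \<exists>\<delta>>0. hol_bound e \<delta>"
  shows "uniformly_convergent_on (stable_pairs X \<R>) (\<lambda>N (x, x'). partial_Delta \<phi> N x' x)"
proof (rule Cauchy_uniformly_convergent, unfold uniformly_Cauchy_on_def, intro allI impI)
  fix e :: real assume "0 < e"
  \<comment> \<open>With \<open>e / 3\<close> the two-sided Cauchy bound is
    \<open>2 * e / 3\<close>, strictly below \<open>e\<close>, uniformly in the rectangle and the
    pair.\<close>
  then obtain \<delta> where \<delta>: "0 < \<delta>" "hol_bound (e / 3) \<delta>" using hb[of "e / 3"] by auto
  obtain M where M: "(1/2 :: real) ^ M < \<delta>" using real_arch_pow_inv[OF \<delta>(1), of "1/2"] by auto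
  have small: "(1/2 :: real) ^ n < \<delta>" if "M \<le> n" for n
  proof -
    have "(1/2 :: real) ^ n \<le> (1/2) ^ M" by (rule power_decreasing[OF that]) auto
    then show ?thesis using M by linarith
  qed
  have "\<bar>partial_Delta \<phi> m x' x - partial_Delta \<phi> n x' x\<bar> < e"
    if "R \<in> \<R>" "x \<in> R" "x' \<in> Ws X R x" "M \<le> m" "M \<le> n" for R x x' m n
    using partial_Delta_Cauchy[OF pos \<delta>(2,1) that(1-3) small small, of m n]
      partial_Delta_Cauchy[OF pos \<delta>(2,1) that(1-3) small small, of n m] that(4,5) \<open>0 < e\<close>
    by (simp add: abs_less_iff)
  then show "\<exists>M. \<forall>p\<in>stable_pairs X \<R>. \<forall>m\<ge>M. \<forall>n\<ge>M.
      dist (case p of (x, x') \<Rightarrow> partial_Delta \<phi> m x' x) (case p of (x, x') \<Rightarrow> partial_Delta \<phi> n x' x) < e"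
    unfolding stable_pairs_def dist_real_def by (intro exI[of _ M]) auto
qed

section \<open>Uniform convergence to the infinite sum\<close>

definition Delta_approximable :: bool where
  "Delta_approximable \<longleftrightarrow> (\<forall>e>0. \<exists>N. \<forall>n\<ge>N. \<forall>R\<in>\<R>. \<forall>x\<in>R. \<forall>x'\<in>Ws X R x.
     \<bar>partial_Delta \<phi> n x' x - Delta_s \<phi> x' x\<bar> < e)"

text \<open>\<open>uniformly_convergent_on\<close> asserts only that some limit exists. Its values
  are the pointwise limits of the partial sums, which shows that the series in
  \<open>Delta_s\<close> converges to it.\<close>

lemma Delta_approximable:
  assumes "uniformly_convergent_on (stable_pairs X \<R>) (\<lambda>N (x, x'). partial_Delta \<phi> N x' x)"
  shows "Delta_approximable"
proof -
  obtain l where l: "uniform_limit (stable_pairs X \<R>) (\<lambda>N (x, x'). partial_Delta \<phi> N x' x) l sequentially"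
    using assms unfolding uniformly_convergent_on_def by blast
  have Delta: "l (x, x') = Delta_s \<phi> x' x" if "(x, x') \<in> stable_pairs X \<R>" for x x'
  proof -
    have "(\<lambda>N. partial_Delta \<phi> N x' x) \<longlonglongrightarrow> l (x, x')"
      using tendsto_uniform_limitI[OF l that] by simp
    then have "(\<lambda>n. \<phi> ((shift ^^ n) x') - \<phi> ((shift ^^ n) x)) sums l (x, x')"
      unfolding sums_def partial_Delta_def .
    then show ?thesis unfolding Delta_s_def by (simp add: sums_iff)
  qed
  show ?thesis
    unfolding Delta_approximable_def
  proof (intro allI impI)
    fix e :: real assume "0 < e"
    then obtain N where "\<forall>n\<ge>N. \<forall>p\<in>stable_pairs X \<R>. dist (case p of (x, x') \<Rightarrow> partial_Delta \<phi> n x' x) (l p) < e"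
      using l unfolding uniform_limit_iff eventually_sequentially by blast
    then have "\<bar>partial_Delta \<phi> n x' x - Delta_s \<phi> x' x\<bar> < e"
      if "N \<le> n" "R \<in> \<R>" "x \<in> R" "x' \<in> Ws X R x" for n R x x'
      using that Delta[of x x'] by (fastforce simp: stable_pairs_def dist_real_def)
    then show "\<exists>N. \<forall>n\<ge>N. \<forall>R\<in>\<R>. \<forall>x\<in>R. \<forall>x'\<in>Ws X R x. \<bar>partial_Delta \<phi> n x' x - Delta_s \<phi> x' x\<bar> < e"
      by blast
  qed
qed

lemma Delta_approximableD:
  assumes "Delta_approximable" "0 < e"
  obtains N where "\<And>n R x x'. N \<le> n \<Longrightarrow> R \<in> \<R> \<Longrightarrow> x \<in> R \<Longrightarrow> x' \<in> Ws X R x \<Longrightarrow>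
    \<bar>partial_Delta \<phi> n x' x - Delta_s \<phi> x' x\<bar> < e"
  using assms unfolding Delta_approximable_def by meson

text \<open>A single \<open>N\<close> with uniform error 1 leaves finitely many terms, each at most
  twice the bound of the potential.\<close>

lemma Delta_s_bounded:
  assumes "Delta_approximable"
  shows "\<exists>B. \<forall>(x, x')\<in>stable_pairs X \<R>. \<bar>Delta_s \<phi> x' x\<bar> \<le> B"
proof -
  obtain N where N: "\<And>n R x x'. N \<le> n \<Longrightarrow> R \<in> \<R> \<Longrightarrow> x \<in> R \<Longrightarrow> x' \<in> Ws X R x \<Longrightarrow>
    \<bar>partial_Delta \<phi> n x' x - Delta_s \<phi> x' x\<bar> < 1"
    using Delta_approximableD[OF assms, of 1] by auto
  obtain B where B: "\<And>y. y \<in> X \<Longrightarrow> \<bar>\<phi> y\<bar> \<le> B" using bounded_\<phi> by blast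
  have "\<bar>Delta_s \<phi> x' x\<bar> \<le> 1 + (\<Sum>n<N. 2 * B)"
    if R: "R \<in> \<R>" "x \<in> R" "x' \<in> Ws X R x" for R x x'
  proof -
    have xX: "x \<in> X" "x' \<in> X" using rectangle_subset[OF R(1)] R by (auto simp: Ws_def)
    have "\<bar>partial_Delta \<phi> N x' x\<bar> \<le> (\<Sum>n<N. \<bar>\<phi> ((shift ^^ n) x') - \<phi> ((shift ^^ n) x)\<bar>)"
      unfolding partial_Delta_def by (rule sum_abs)
    also have "\<dots> \<le> (\<Sum>n<N. 2 * B)"
    proof (rule sum_mono)
      fix n
      show "\<bar>\<phi> ((shift ^^ n) x') - \<phi> ((shift ^^ n) x)\<bar> \<le> 2 * B"
        using B[of "(shift ^^ n) x'"] B[of "(shift ^^ n) x"] xX by simp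
    qed
    finally show ?thesis using N[OF _ R, of N] by simp
  qed
  then show ?thesis
    unfolding stable_pairs_def by (intro exI[of _ "1 + (\<Sum>n<N. 2 * B)"]) auto
qed

section \<open>The density of a holonomy\<close>

lemma Delta_s_hol_measurable:
  assumes R: "R \<in> \<R>" "y \<in> R" "z \<in> R" and \<Delta>: "Delta_approximable"
  shows "(\<lambda>x. Delta_s \<phi> (hol y z x) x) \<in> borel_measurable (leaf_measure X \<phi> R y)"
proof (rule borel_measurable_LIMSEQ_real)
  fix n
  have S: "birkhoff \<phi> n \<in> borel_measurable (leaf_measure X \<phi> R p)" for p
    by (rule borel_measurable_leaf) (rule birkhoff_uniformly_continuous)
  show "(\<lambda>x. partial_Delta \<phi> n (hol y z x) x) \<in> borel_measurable (leaf_measure X \<phi> R y)"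
    unfolding partial_Delta_eq
    using measurable_compose[OF hol_measurable[OF R] S] S by (rule borel_measurable_diff)
next
  fix x assume "x \<in> space (leaf_measure X \<phi> R y)"
  then have x: "x \<in> Wu X R y" by simp
  show "(\<lambda>n. partial_Delta \<phi> n (hol y z x) x) \<longlonglongrightarrow> Delta_s \<phi> (hol y z x) x"
  proof (rule LIMSEQ_I)
    fix e :: real assume "0 < e"
    with \<Delta> obtain N where "\<And>n R x x'. N \<le> n \<Longrightarrow> R \<in> \<R> \<Longrightarrow> x \<in> R \<Longrightarrow> x' \<in> Ws X R x \<Longrightarrow>
      \<bar>partial_Delta \<phi> n x' x - Delta_s \<phi> x' x\<bar> < e"
      using Delta_approximableD by blast
    then show "\<exists>N. \<forall>n\<ge>N. norm (partial_Delta \<phi> n (hol y z x) x - Delta_s \<phi> (hol y z x) x) < e"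
      using R(1) Wu_subset_rectangle[OF x] hol_Ws[OF R x] by (intro exI[of _ N]) auto
  qed
qed

text \<open>A finite alphabet has finitely many words of length \<open>L\<close>, and their
  cylinders partition the leaf, so the local inequalities form a finite sum.\<close>

lemma emeasure_le_by_cylinders:
  assumes sets: "sets M = sets (leaf_measure X \<phi> R y)" "sets N = sets (leaf_measure X \<phi> R y)"
    and Y: "Y \<in> sets (leaf_measure X \<phi> R y)"
    and le: "\<And>u Z. length u = L \<Longrightarrow> Z \<in> sets (leaf_measure X \<phi> R y) \<Longrightarrow> Z \<subseteq> cyl_plus X u \<Longrightarrow>
      emeasure M Z \<le> c * emeasure N Z"
  shows "emeasure M Y \<le> c * emeasure N Y"
proof -
  define I where "I = {u :: 'a list. length u = L}"
  have fin: "finite I" unfolding I_def using finite_lists_length_eq[of "UNIV :: 'a set" L] by simp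
  have YW: "Y \<subseteq> Wu X R y" using Y by (rule sets_leaf_subset)
  have Yu: "Y \<inter> cyl_plus X u \<in> sets (leaf_measure X \<phi> R y)" for u
  proof -
    have "Y \<inter> cyl_plus X u = Y \<inter> (Wu X R y \<inter> cyl_plus X u)" using YW by blast
    then show ?thesis using sets.Int[OF Y cyl_in_sets_leaf] by simp
  qed
  have disj: "disjoint_family_on (\<lambda>u. Y \<inter> cyl_plus X u) I"
    unfolding disjoint_family_on_def
  proof (intro ballI impI equals0I)
    fix u v x assume "u \<in> I" "v \<in> I" "u \<noteq> v" "x \<in> Y \<inter> cyl_plus X u \<inter> (Y \<inter> cyl_plus X v)"
    then have "u = v" by (intro nth_equalityI) (auto simp: I_def cyl_plus_def)
    then show False using \<open>u \<noteq> v\<close> by blast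
  qed
  have "Y \<subseteq> (\<Union>u\<in>I. Y \<inter> cyl_plus X u)"
  proof
    fix x assume "x \<in> Y"
    then have "x \<in> cyl_plus X (prefix L x)" using YW Wu_subset[of X R y] by (auto simp: in_cyl_prefix_iff)
    then show "x \<in> (\<Union>u\<in>I. Y \<inter> cyl_plus X u)" using \<open>x \<in> Y\<close> by (intro UN_I[of "prefix L x"]) (simp_all add: I_def)
  qed
  then have un: "(\<Union>u\<in>I. Y \<inter> cyl_plus X u) = Y" by blast
  have sum: "emeasure K Y = (\<Sum>u\<in>I. emeasure K (Y \<inter> cyl_plus X u))"
    if "sets K = sets (leaf_measure X \<phi> R y)" for K
  proof -
    have "(\<lambda>u. Y \<inter> cyl_plus X u) ` I \<subseteq> sets K" unfolding that using Yu by blast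
    then show ?thesis using sum_emeasure[OF _ disj fin, of K] by (simp only: un)
  qed
  have "emeasure M Y \<le> (\<Sum>u\<in>I. c * emeasure N (Y \<inter> cyl_plus X u))"
    unfolding sum[OF sets(1)] using le Yu by (intro sum_mono) (auto simp: I_def)
  then show ?thesis by (simp add: sum[OF sets(2)] sum_distrib_left)
qed

text \<open>On a short enough piece of the leaf both measures are nearly \<open>exp c\<close> times
  \<open>mu X \<phi> y\<close>, with one constant \<open>c\<close>. This compares them up to a
  factor \<open>exp e\<close> on each cylinder, then on every Borel set, and \<open>e\<close> tends
  to 0.\<close>

lemma density_hol:
  assumes pos: "positive_on X \<phi> \<R>" and hb: "\<And>e. 0 < e \<Longrightarrow> \<exists>\<delta>>0. hol_bound e \<delta>"
    and \<Delta>: "Delta_approximable" and R: "R \<in> \<R>" "y \<in> R" "z \<in> R"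
  shows "density (leaf_measure X \<phi> R y) (\<lambda>x. ennreal (exp (Delta_s \<phi> (hol y z x) x)))
    = distr (leaf_measure X \<phi> R z) (leaf_measure X \<phi> R y) (hol z y)" (is "density ?M ?f = ?D")
proof -
  have f: "?f \<in> borel_measurable ?M"
    by (intro measurable_compose[OF Delta_s_hol_measurable[OF R \<Delta>]]) measurable
  have main: "\<exists>L. \<forall>u Z. length u = L \<longrightarrow> Z \<in> sets ?M \<longrightarrow> Z \<subseteq> cyl_plus X u \<longrightarrow>
      emeasure ?D Z \<le> ennreal (exp e) * emeasure (density ?M ?f) Z \<and>
      emeasure (density ?M ?f) Z \<le> ennreal (exp e) * emeasure ?D Z" if "0 < e" for e
  proof -
    \<comment> \<open>Six errors occur: the holonomy bound and two oscillations in comparing the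
      leaves, then two oscillations and one tail of the series in replacing the density by the
      constant \<open>exp c\<close>.\<close>
    define \<eta> where "\<eta> = e / 6"
    have \<eta>: "0 < \<eta>" using that by (simp add: \<eta>_def)
    obtain \<delta> where \<delta>: "0 < \<delta>" "hol_bound \<eta> \<delta>" using hb[OF \<eta>] by blast
    obtain N where N: "\<And>n R x x'. N \<le> n \<Longrightarrow> R \<in> \<R> \<Longrightarrow> x \<in> R \<Longrightarrow> x' \<in> Ws X R x \<Longrightarrow>
      \<bar>partial_Delta \<phi> n x' x - Delta_s \<phi> x' x\<bar> < \<eta>"
      using Delta_approximableD[OF \<Delta> \<eta>] by blast
    obtain n0 where n0: "(1/2 :: real) ^ n0 < \<delta>" using real_arch_pow_inv[OF \<delta>(1), of "1/2"] by auto
    define n where "n = max N n0"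
    have n: "(1/2 :: real) ^ n < \<delta>"
    proof -
      have "(1/2 :: real) ^ n \<le> (1/2) ^ n0" by (rule power_decreasing) (auto simp: n_def)
      then show ?thesis using n0 by linarith
    qed
    obtain k where k: "window n \<eta> k" using window_exists[OF \<eta>] by blast
    have "emeasure ?D Z \<le> ennreal (exp e) * emeasure (density ?M ?f) Z \<and>
        emeasure (density ?M ?f) Z \<le> ennreal (exp e) * emeasure ?D Z"
      if u: "length u = Suc (max n k)" and Z: "Z \<in> sets ?M" "Z \<subseteq> cyl_plus X u" for u Z
    proof (cases "Z = {}")
      case False
      then obtain x0 where x0: "x0 \<in> Z" by blast
      have ZW: "Z \<subseteq> Wu X R y" using Z(1) by (rule sets_leaf_subset)
      define c where "c = partial_Delta \<phi> n (hol y z x0) x0"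
      have close: "\<bar>Delta_s \<phi> (hol y z x) x - c\<bar> \<le> 3 * \<eta>" if x: "x \<in> Z" for x
      proof -
        have xW: "x \<in> Wu X R y" and x0W: "x0 \<in> Wu X R y" using x x0 ZW by blast+
        have "\<bar>birkhoff \<phi> n x - birkhoff \<phi> n x0\<bar> \<le> \<eta>"
          using x x0 Z(2) xW x0W u by (intro window_leaf[OF k, of u _ y]) (auto simp: Wu_def)
        moreover have "\<bar>birkhoff \<phi> n (hol y z x) - birkhoff \<phi> n (hol y z x0)\<bar> \<le> \<eta>"
          using x x0 Z(2) hol_mem[OF R(1,3)] hol_cyl[OF R(1,3)] Wu_subset_rectangle[OF xW]
            Wu_subset_rectangle[OF x0W] u
          by (intro window_leaf[OF k, of u _ z]) (auto simp: Wu_def)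
        moreover have "\<bar>partial_Delta \<phi> n (hol y z x) x - Delta_s \<phi> (hol y z x) x\<bar> < \<eta>"
          using Wu_subset_rectangle[OF xW] hol_Ws[OF R xW] by (intro N[OF _ R(1)]) (auto simp: n_def)
        ultimately show ?thesis unfolding c_def partial_Delta_eq by linarith
      qed
      have x0W: "x0 \<in> Wu X R y \<inter> cyl_plus X u" using x0 ZW Z(2) by blast
      have nu: "n < length u" "k < length u" using u by auto
      have D: "emeasure ?D Z = mu X \<phi> z (hol y z ` Z)" by (rule emeasure_distr_hol[OF R Z(1)])
      have M: "emeasure ?M Z = mu X \<phi> y Z" by (rule emeasure_leaf_measure[OF Z(1)])
      have dens: "emeasure (density ?M ?f) Z = (\<integral>\<^sup>+x. ?f x * indicator Z x \<partial>?M)"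
        by (rule emeasure_density[OF f Z(1)])
      have const: "(\<integral>\<^sup>+x. ennreal (exp t) * indicator Z x \<partial>?M) = ennreal (exp t) * mu X \<phi> y Z" for t
        using Z(1) by (simp add: nn_integral_cmult_indicator M)
      have lower: "ennreal (exp (c - 3 * \<eta>)) * mu X \<phi> y Z \<le> emeasure (density ?M ?f) Z"
        unfolding dens const[symmetric] using close
        by (intro nn_integral_mono) (fastforce simp: indicator_def abs_le_iff intro!: ennreal_leI)
      have upper: "emeasure (density ?M ?f) Z \<le> ennreal (exp (c + 3 * \<eta>)) * mu X \<phi> y Z"
        unfolding dens const[symmetric] using close
        by (intro nn_integral_mono) (fastforce simp: indicator_def abs_le_iff intro!: ennreal_leI)
      have "mu X \<phi> z (hol y z ` Z) \<le> ennreal (exp (c + \<eta> + 2 * \<eta>)) * mu X \<phi> y Z"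
        unfolding c_def by (rule hol_le[OF R \<delta>(2) n nu k x0W Z])
      also have "\<dots> = ennreal (exp e) * (ennreal (exp (c - 3 * \<eta>)) * mu X \<phi> y Z)"
        unfolding ennreal_exp_mult by (simp add: \<eta>_def algebra_simps)
      also have "\<dots> \<le> ennreal (exp e) * emeasure (density ?M ?f) Z"
        using lower by (rule mult_left_mono) simp
      finally have 1: "emeasure ?D Z \<le> ennreal (exp e) * emeasure (density ?M ?f) Z" unfolding D .
      have "emeasure (density ?M ?f) Z \<le> ennreal (exp (c + 3 * \<eta>)) *
          (ennreal (exp (- c + \<eta> + 2 * \<eta>)) * mu X \<phi> z (hol y z ` Z))"
        using upper mult_left_mono[OF hol_ge[OF R \<delta>(2) n nu k x0W Z], of "ennreal (exp (c + 3 * \<eta>))"]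
        unfolding c_def by (meson order_trans zero_le)
      also have "\<dots> = ennreal (exp e) * emeasure ?D Z"
        unfolding ennreal_exp_mult D by (simp add: \<eta>_def)
      finally show ?thesis using 1 by blast
    qed simp
    then show ?thesis by blast
  qed
  show ?thesis
  proof (rule measure_eqI)
    fix Y assume "Y \<in> sets (density ?M ?f)"
    then have Y: "Y \<in> sets ?M" by simp
    \<comment> \<open>The length \<open>L\<close> depends on \<open>e\<close>, but the inequality on
      \<open>Y\<close> no longer mentions it, so \<open>e\<close> can tend to 0.\<close>
    have le: "emeasure (density ?M ?f) Y \<le> ennreal (exp e) * emeasure ?D Y"
      "emeasure ?D Y \<le> ennreal (exp e) * emeasure (density ?M ?f) Y" if e: "0 < e" for e
    proof -
      obtain L where L: "\<And>u Z. length u = L \<Longrightarrow> Z \<in> sets ?M \<Longrightarrow> Z \<subseteq> cyl_plus X u \<Longrightarrow>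
        emeasure ?D Z \<le> ennreal (exp e) * emeasure (density ?M ?f) Z \<and>
        emeasure (density ?M ?f) Z \<le> ennreal (exp e) * emeasure ?D Z"
        using main[OF e] by blast
      show "emeasure (density ?M ?f) Y \<le> ennreal (exp e) * emeasure ?D Y"
        by (rule emeasure_le_by_cylinders[OF _ _ Y, where L = L]) (use L in auto)
      show "emeasure ?D Y \<le> ennreal (exp e) * emeasure (density ?M ?f) Y"
        by (rule emeasure_le_by_cylinders[OF _ _ Y, where L = L]) (use L in auto)
    qed
    show "emeasure (density ?M ?f) Y = emeasure ?D Y"
      using ennreal_le_of_exp_mult[OF le(1)] ennreal_le_of_exp_mult[OF le(2)] by (rule antisym)
  qed simp
qed

text \<open>The tail of the series is cut at \<open>n\<close> with error \<open>e / 2\<close>; then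
  \<open>k\<close> is chosen for this \<open>n\<close>, so that the partial sum is at most
  \<open>e / 2\<close> for points agreeing up to radius \<open>k\<close>. Hence the density is at
  most \<open>exp e\<close> between leaves closer than \<open>(1/2) ^ k\<close>.\<close>

lemma hol_bound_of_density:
  assumes \<Delta>: "Delta_approximable"
    and dens: "\<And>R y z. R \<in> \<R> \<Longrightarrow> y \<in> R \<Longrightarrow> z \<in> R \<Longrightarrow>
      density (leaf_measure X \<phi> R y) (\<lambda>x. ennreal (exp (Delta_s \<phi> (hol y z x) x)))
      = distr (leaf_measure X \<phi> R z) (leaf_measure X \<phi> R y) (hol z y)"
    and e: "0 < e"
  shows "\<exists>\<delta>>0. hol_bound e \<delta>"
proof -
  obtain n where "\<And>m R x x'. n \<le> m \<Longrightarrow> R \<in> \<R> \<Longrightarrow> x \<in> R \<Longrightarrow> x' \<in> Ws X R x \<Longrightarrow>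
      \<bar>partial_Delta \<phi> m x' x - Delta_s \<phi> x' x\<bar> < e / 2"
    using Delta_approximableD[OF \<Delta> half_gt_zero[OF e]] by blast
  note n = this[OF order_refl]
  obtain k where k: "window n (e / 2) k" using window_exists[of "e / 2" n] e by auto
  have "hol_bound e ((1/2) ^ k)"
    unfolding hol_bound_def
  proof (intro ballI impI)
    fix R y z Y assume R: "R \<in> \<R>" "y \<in> R" "z \<in> R" and d: "bidist y z < (1/2) ^ k"
      and Y: "Y \<in> sets (leaf_measure X \<phi> R y)"
    let ?M = "leaf_measure X \<phi> R y" and ?f = "\<lambda>x. ennreal (exp (Delta_s \<phi> (hol y z x) x))"
    have le: "Delta_s \<phi> (hol y z x) x \<le> e" if x: "x \<in> Wu X R y" for x
    proof -
      \<comment> \<open>Nonpositive coordinates agree because \<open>y\<close> and \<open>z\<close>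
        are close, positive ones because the holonomy does not change them.\<close>
      have "hol y z x i = x i" if "nat \<bar>i\<bar> \<le> k" for i
        using bidist_agree[OF d that] x by (simp add: hol_def bracket_def Wu_def Wu_loc_def)
      moreover have "x \<in> X" "hol y z x \<in> X"
        using x Wu_subset[of X R] hol_mem[OF R(1,3) Wu_subset_rectangle[OF x]] by blast+
      ultimately have "\<bar>birkhoff \<phi> n (hol y z x) - birkhoff \<phi> n x\<bar> \<le> e / 2"
        using k unfolding window_def by blast
      then show ?thesis
        using n[OF R(1) Wu_subset_rectangle[OF x] hol_Ws[OF R x]] unfolding partial_Delta_eq by linarith
    qed
    have f: "?f \<in> borel_measurable ?M"
      by (intro measurable_compose[OF Delta_s_hol_measurable[OF R \<Delta>]]) measurable
    have "mu X \<phi> z (hol y z ` Y) = (\<integral>\<^sup>+x. ?f x * indicator Y x \<partial>?M)"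
      using emeasure_density[OF f Y] unfolding dens[OF R] emeasure_distr_hol[OF R Y] .
    also have "\<dots> \<le> (\<integral>\<^sup>+x. ennreal (exp e) * indicator Y x \<partial>?M)"
      using le by (intro nn_integral_mono mult_right_mono ennreal_leI) auto
    also have "\<dots> = ennreal (exp e) * mu X \<phi> y Y"
      using Y by (simp add: nn_integral_cmult_indicator emeasure_leaf_measure)
    finally show "mu X \<phi> z (hol y z ` Y) \<le> ennreal (exp e) * mu X \<phi> y Y" .
  qed
  then show ?thesis by (intro exI[of _ "(1/2) ^ k"]) simp
qed

lemma inv_into_hol:
  assumes R: "R \<in> \<R>" "y \<in> R" "z \<in> R" and x: "x \<in> Wu X R y"
  shows "inv_into (Wu X R z) (hol z y) x = hol y z x"
proof (rule inv_into_f_eq)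
  show "inj_on (hol z y) (Wu X R z)" by (rule inj_on_inverseI[of _ "hol y z"]) (rule hol_hol)
  show "hol y z x \<in> Wu X R z" using hol_mem[OF R(1,3) Wu_subset_rectangle[OF x]] .
  show "hol z y (hol y z x) = x" using x by (rule hol_hol)
qed

text \<open>\<open>inv_into\<close> is the reverse holonomy only on the leaf, which is the whole
  space of the measure. The measurability required by \<open>is_RN_deriv\<close> comes from the
  convergence of the partial sums.\<close>

lemma is_RN_deriv_hol_iff:
  assumes R: "R \<in> \<R>" "y \<in> R" "z \<in> R" and \<Delta>: "Delta_approximable"
  shows "is_RN_deriv (leaf_measure X \<phi> R y) (distr (leaf_measure X \<phi> R z) (leaf_measure X \<phi> R y) (hol z y))
      (\<lambda>x. ennreal (exp (Delta_s \<phi> (inv_into (Wu X R z) (hol z y) x) x))) \<longleftrightarrow>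
    density (leaf_measure X \<phi> R y) (\<lambda>x. ennreal (exp (Delta_s \<phi> (hol y z x) x)))
      = distr (leaf_measure X \<phi> R z) (leaf_measure X \<phi> R y) (hol z y)" (is "is_RN_deriv ?M ?D ?g \<longleftrightarrow> density ?M ?f = ?D")
proof -
  have eq: "?g x = ?f x" if "x \<in> space ?M" for x
    using that inv_into_hol[OF R] by simp
  have f: "?f \<in> borel_measurable ?M"
    by (intro measurable_compose[OF Delta_s_hol_measurable[OF R \<Delta>]]) measurable
  then have g: "?g \<in> borel_measurable ?M"
    using measurable_cong[of ?M ?g ?f borel] eq by blast
  have "density ?M ?g = density ?M ?f"
    using eq by (intro density_cong g f) auto
  then show ?thesis using g by (simp add: is_RN_deriv_def)
qed

end

theorem theorem1p15:
  fixes X :: "('a::finite) biseq set" and \<phi> :: "'a biseq \<Rightarrow> real" and \<R> :: "'a biseq set set"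
  assumes "shift_space X"
    and "continuous_map (subtopology bitop X) euclideanreal \<phi>"
    and "\<forall>R\<in>\<R>. rectangle X R"
    and "lang_invariant X \<R>"
    and "positive_on X \<phi> \<R>"
    \<comment> \<open>presupposed by the Radon--Nikodym derivatives with respect to these measures\<close>
    and "\<forall>R\<in>\<R>. \<forall>y\<in>R. sigma_finite_measure (leaf_measure X \<phi> R y)"
  shows "unif_cont_holonomies X \<phi> \<R> \<longleftrightarrow>
     (uniformly_convergent_on (stable_pairs X \<R>)
        (\<lambda>N (x, x'). \<Sum>n<N. \<phi> ((shift ^^ n) x') - \<phi> ((shift ^^ n) x)) \<and>
      (\<exists>B. \<forall>(x, x')\<in>stable_pairs X \<R>. \<bar>Delta_s \<phi> x' x\<bar> \<le> B) \<and>
      (\<forall>R\<in>\<R>. \<forall>y\<in>R. \<forall>z\<in>R.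
         is_RN_deriv (leaf_measure X \<phi> R y)
           (distr (leaf_measure X \<phi> R z) (leaf_measure X \<phi> R y) (hol z y))
           (\<lambda>x. ennreal (exp (Delta_s \<phi> (inv_into (Wu X R z) (hol z y) x) x)))))"
proof -
  interpret rectangle_family X \<phi> \<R>
    using assms unfolding shift_space_def
    by (intro rectangle_family.intro rectangle_family_axioms.intro continuous_potential.intro
        continuous_potential_axioms.intro invariant_set.intro) blast+
  show ?thesis
    unfolding unif_cont_holonomies_iff partial_Delta_def[symmetric]
  proof (intro iffI conjI ballI; (elim conjE)?)
    assume hb: "\<forall>e>0. \<exists>\<delta>>0. hol_bound e \<delta>"
    show conv: "uniformly_convergent_on (stable_pairs X \<R>) (\<lambda>N (x, x'). partial_Delta \<phi> N x' x)"
      using hb by (intro partial_Delta_uniformly_convergent[OF assms(5)]) blast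
    \<comment> \<open>Convergence has to come first: it makes \<open>Delta_s\<close> a genuine
      limit, on which the bound and the measurability of the density rest.\<close>
    note \<Delta> = Delta_approximable[OF conv]
    show "\<exists>B. \<forall>(x, x')\<in>stable_pairs X \<R>. \<bar>Delta_s \<phi> x' x\<bar> \<le> B" by (rule Delta_s_bounded[OF \<Delta>])
    show "is_RN_deriv (leaf_measure X \<phi> R y) (distr (leaf_measure X \<phi> R z) (leaf_measure X \<phi> R y) (hol z y))
        (\<lambda>x. ennreal (exp (Delta_s \<phi> (inv_into (Wu X R z) (hol z y) x) x)))"
      if R: "R \<in> \<R>" "y \<in> R" "z \<in> R" for R y z
      unfolding is_RN_deriv_hol_iff[OF R \<Delta>] using hb by (intro density_hol[OF assms(5) _ \<Delta> R]) blast
  next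
    assume conv: "uniformly_convergent_on (stable_pairs X \<R>) (\<lambda>N (x, x'). partial_Delta \<phi> N x' x)"
      and rn: "\<forall>R\<in>\<R>. \<forall>y\<in>R. \<forall>z\<in>R. is_RN_deriv (leaf_measure X \<phi> R y)
        (distr (leaf_measure X \<phi> R z) (leaf_measure X \<phi> R y) (hol z y))
        (\<lambda>x. ennreal (exp (Delta_s \<phi> (inv_into (Wu X R z) (hol z y) x) x)))"
    note \<Delta> = Delta_approximable[OF conv]
    show "\<forall>e>0. \<exists>\<delta>>0. hol_bound e \<delta>"
      using rn is_RN_deriv_hol_iff[OF _ _ _ \<Delta>] by (intro allI impI hol_bound_of_density[OF \<Delta>]) blast+
  qed
qed

end
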